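(* Let $(R,\mathfrak m)$ be a regular local ring and let $\{(R_n,\mathfrak m_n)\}_{n\ge 0}$ be an infinite directed family of local quadratic transforms of $R=R_0$. Assume that $\{(R_n,\mathfrak m_n)\}_{n\ge 0}$ switches strongly infinitely often, so that $V=\bigcup_{n=0}^{\infty}R_n$ is a rank one valuation domain. Let $v$ be a (real-valued) valuation associated to $V$. Then for all nonzero $f,g\in\mathfrak m$, $$\frac{v(f)}{v(g)}=\lim_{n\to\infty}\frac{\operatorname{ord}_{R_n}(f)}{\operatorname{ord}_{R_n}(g)}.$$
   Context: For a regular local ring $(A,\mathfrak n)$ and nonzero $a\in A$, $\operatorname{ord}_A(a)$ is the integer $r\ge0$ with $a\in\mathfrak n^r\setminus\mathfrak n^{r+1}$. A local quadratic transform of $(A,\mathfrak n)$ is a ring $A[\mathfrak n/x]_{\mathfrak p}$, where $x\in\mathfrak n\setminus\mathfrak n^2$ and $\mathfrak p$ is a prime ideal of $A[\mathfrak n/x]$ containing $\mathfrak n$; it is again a regular local ring. An infinite directed family of local quadratic transforms of a $d$-dimensional regular local ring $R$ is a sequence $R=R_0\subset R_1\subset R_2\subset\cdots$ of $d$-dimensional regular local rings $(R_n,\mathfrak m_n)$ such that $R_{n+1}$ is a local quadratic transform of $R_n$ for each $n\ge 0$. The family switches strongly infinitely often if there do not exist an integer $j\ge0$ and a height one prime ideal $\mathfrak p_j$ of $R_j$ with $\bigcup_{n\ge 0}R_n\subset (R_j)_{\mathfrak p_j}$. It is known that if the family switches strongly infinitely often, then $\bigcup_{n\ge0}R_n$ is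 a rank one valuation domain (rank = Krull dimension). *)

theory Defs
  imports
    Complex_Main
    "HOL-Library.Extended_Nat"
    "HOL-Algebra.Ring_Divisibility"
    "HOL-Algebra.Ideal_Product"
    "HOL-Algebra.Generated_Rings"
begin

section \<open>Regular local rings\<close>

text \<open>A chain has \<open>n + 1\<close> members and length \<open>n\<close>.\<close>

definition prime_chain :: "('a, 'b) ring_scheme \<Rightarrow> nat \<Rightarrow> (nat \<Rightarrow> 'a set) \<Rightarrow> bool"
  where "prime_chain R n P \<longleftrightarrow>
    (\<forall>i\<le>n. primeideal (P i) R) \<and> (\<forall>i<n. P i \<subset> P (Suc i))"

definition krull_dim :: "('a, 'b) ring_scheme \<Rightarrow> enat"
  where "krull_dim R = Sup {enat n | n. \<exists>P. prime_chain R n P}"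

definition height :: "('a, 'b) ring_scheme \<Rightarrow> 'a set \<Rightarrow> enat"
  where "height R p = Sup {enat n | n. \<exists>P. prime_chain R n P \<and> P n = p}"

text \<open>The minimal number of generators of an ideal; meaningful only if the ideal is finitely
  generated, since \<^const>\<open>Least\<close> is unspecified otherwise.\<close>

definition min_gens :: "('a, 'b) ring_scheme \<Rightarrow> 'a set \<Rightarrow> nat"
  where "min_gens R I =
    (LEAST n. \<exists>S \<subseteq> carrier R. finite S \<and> card S = n \<and> I = Idl\<^bsub>R\<^esub> S)"

locale local_ring = maximalideal \<mm> R + cring R for \<mm> and R (structure) +
  assumes unique_maximal: "maximalideal J R \<Longrightarrow> J = \<mm>"

locale regular_local_ring = local_ring \<mm> R + noetherian_ring R for \<mm> and R (structure) +
  assumes regular: "enat (min_gens R \<mm>) = krull_dim R"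

text \<open>Powers are taken in the multiplicative monoid of ideals, so that the zeroth power is the
  whole ring.\<close>

definition ideal_pow :: "('a, 'b) ring_scheme \<Rightarrow> 'a set \<Rightarrow> nat \<Rightarrow> 'a set"
  where "ideal_pow R I r = I [^]\<^bsub>ideals_set R\<^esub> r"

text \<open>Used only for nonzero elements \<open>a\<close> of a regular local ring with maximal ideal \<open>\<mm>\<close>.\<close>

definition ord_at :: "('a, 'b) ring_scheme \<Rightarrow> 'a set \<Rightarrow> 'a \<Rightarrow> nat"
  where "ord_at R \<mm> a = (THE r. a \<in> ideal_pow R \<mm> r - ideal_pow R \<mm> (Suc r))"


section \<open>Local quadratic transforms\<close>

text \<open>From here on, all rings are subrings of an ambient field \<open>K\<close>, given by their carriers.\<close>

abbreviation restrict_ring :: "('a, 'b) ring_scheme \<Rightarrow> 'a set \<Rightarrow> ('a, 'b) ring_scheme"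
  where "restrict_ring K A \<equiv> K\<lparr>carrier := A\<rparr>"

definition is_quotient_field :: "('a, 'b) ring_scheme \<Rightarrow> 'a set \<Rightarrow> bool"
  where "is_quotient_field K A \<longleftrightarrow> field K \<and> subring A K \<and>
    carrier K = {a \<otimes>\<^bsub>K\<^esub> inv\<^bsub>K\<^esub> b | a b. a \<in> A \<and> b \<in> A - {\<zero>\<^bsub>K\<^esub>}}"

definition localization_in :: "('a, 'b) ring_scheme \<Rightarrow> 'a set \<Rightarrow> 'a set \<Rightarrow> 'a set"
  where "localization_in K A p = {a \<otimes>\<^bsub>K\<^esub> inv\<^bsub>K\<^esub> s | a s. a \<in> A \<and> s \<in> A - p}"

text \<open>The ring \<open>A[\<nn>/x]\<close>.\<close>

definition blowup_chart :: "('a, 'b) ring_scheme \<Rightarrow> 'a set \<Rightarrow> 'a set \<Rightarrow> 'a \<Rightarrow> 'a set"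
  where "blowup_chart K A \<nn> x =
    generate_ring K (A \<union> {y \<otimes>\<^bsub>K\<^esub> inv\<^bsub>K\<^esub> x | y. y \<in> \<nn>})"

definition local_quadratic_transform ::
    "('a, 'b) ring_scheme \<Rightarrow> 'a set \<Rightarrow> 'a set \<Rightarrow> 'a set \<Rightarrow> bool"
  where "local_quadratic_transform K A \<nn> B \<longleftrightarrow>
    (\<exists>x \<in> \<nn> - ideal_pow (restrict_ring K A) \<nn> 2. \<exists>p.
       primeideal p (restrict_ring K (blowup_chart K A \<nn> x)) \<and> \<nn> \<subseteq> p \<and>
       B = localization_in K (blowup_chart K A \<nn> x) p)"

locale quadratic_family = field K for K (structure) +
  fixes R :: "nat \<Rightarrow> 'a set" and \<mm> :: "nat \<Rightarrow> 'a set"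
  assumes quotient_field: "is_quotient_field K (R 0)"
    and subring: "subring (R n) K"
    and regular_local: "regular_local_ring (\<mm> n) (restrict_ring K (R n))"
    and dim_constant: "krull_dim (restrict_ring K (R n)) = krull_dim (restrict_ring K (R 0))"
    and increasing: "R n \<subseteq> R (Suc n)"
    and quadratic_transform: "local_quadratic_transform K (R n) (\<mm> n) (R (Suc n))"

definition switches_strongly_infinitely_often ::
    "('a, 'b) ring_scheme \<Rightarrow> (nat \<Rightarrow> 'a set) \<Rightarrow> bool"
  where "switches_strongly_infinitely_often K R \<longleftrightarrow>
    \<not> (\<exists>j p. primeideal p (restrict_ring K (R j)) \<and> height (restrict_ring K (R j)) p = 1 \<and>
             (\<Union>n. R n) \<subseteq> localization_in K (R j) p)"


section \<open>Real-valued valuations\<close>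

text \<open>The value at zero, which would be infinity, is irrelevant and left unconstrained.\<close>

locale real_valuation = field K for K (structure) +
  fixes v :: "'a \<Rightarrow> real"
  assumes val_mult: "\<lbrakk>x \<in> carrier K - {\<zero>}; y \<in> carrier K - {\<zero>}\<rbrakk> \<Longrightarrow> v (x \<otimes> y) = v x + v y"
    and val_add: "\<lbrakk>x \<in> carrier K - {\<zero>}; y \<in> carrier K - {\<zero>}; x \<oplus> y \<noteq> \<zero>\<rbrakk>
      \<Longrightarrow> min (v x) (v y) \<le> v (x \<oplus> y)"

definition valuation_ring :: "('a, 'b) ring_scheme \<Rightarrow> ('a \<Rightarrow> real) \<Rightarrow> 'a set"
  where "valuation_ring K v = {x \<in> carrier K. x = \<zero>\<^bsub>K\<^esub> \<or> 0 \<le> v x}"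

end

theory Submission
  imports Defs
begin

text \<open>The limit formula rests on one observation. Let \<open>p\<close> and \<open>q\<close> be natural numbers with \<open>q v(g) \<le> p v(f)\<close>. Then
\<open>f\<^sup>p / g\<^sup>q\<close> lies in the valuation ring \<open>V\<close>, hence in \<open>R\<^sub>n\<close> for all large \<open>n\<close>. As the order function of
\<open>R\<^sub>n\<close> is additive on products, \<open>q ord(g) \<le> p ord(f)\<close> for these \<open>n\<close> (\<open>eventually_order_le\<close>). The same
holds with \<open>f\<close> and \<open>g\<close> exchanged, so every rational number on one side of \<open>v(f)/v(g)\<close> is eventually on the same
side, in the weak sense, of \<open>ord(f)/ord(g)\<close>. This proves convergence, once \<open>v\<close> is known to be positive on the
maximal ideals (\<open>val_pos\<close>). Positivity also shows that no nonzero element lies in all powers of a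
maximal ideal, so that orders exist (\<open>not_in_all_powers\<close>).

What remains is that in a regular local ring \<open>(R, \<mm>)\<close> orders are additive, that is, that
the associated graded ring is a domain (\<open>graded_prime_maximal_ideal\<close>). By definition there are \<open>d\<close> generators of
\<open>\<mm>\<close> and a chain of primes of length \<open>d\<close>. Krull's principal ideal theorem allows one to push such a chain through
a prescribed element at the cost of one step (\<open>prime_chain_through\<close>). With Nakayama's lemma it follows
that, in a suitable order, the generators \<open>x\<^sub>1, \<dots>, x\<^sub>d\<close> have the property that each ideal
\<open>(x\<^sub>1, \<dots>, x\<^sub>i)\<close> is prime and does not contain \<open>x\<^bsub>i+1\<^esub>\<close> (\<open>graded_prime_of_chain\<close>). Along this sequence
one shows that the associated graded rings are domains, even after base change to a residue ring modulo any larger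
prime (\<open>graded_prime_adjoin\<close>).\<close>

section \<open>Ideals of Noetherian rings\<close>

lemma (in noetherian_ring) exists_maximal_ideal_with:
  assumes "ideal I R" "\<Phi> I"
  obtains M where "ideal M R" "\<Phi> M" "\<And>J. ideal J R \<Longrightarrow> \<Phi> J \<Longrightarrow> M \<subseteq> J \<Longrightarrow> J = M"
proof -
  define S where "S = {J. ideal J R \<and> \<Phi> J}"
  have "\<exists>M\<in>S. \<forall>J\<in>S. M \<subseteq> J \<longrightarrow> J = M"
  proof (rule subset_Zorn)
    fix C assume C: "subset.chain S C"
    show "\<exists>U\<in>S. \<forall>X\<in>C. X \<subseteq> U"
    proof (cases "C = {}")
      case True
      have "I \<in> S" using assms unfolding S_def by simp
      then show ?thesis using True by auto
    next
      case False
      have "S \<subseteq> {I. ideal I R}" unfolding S_def by blast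
      then have "subset.chain {I. ideal I R} C"
        using C unfolding pred_on.chain_def by auto
      from ideal_chain_is_trivial[OF False this] have "\<Union>C \<in> C" .
      moreover have "C \<subseteq> S" using C unfolding pred_on.chain_def by simp
      ultimately show ?thesis by (meson Union_upper subsetD)
    qed
  qed
  then obtain M where "M \<in> S" "\<And>J. J \<in> S \<Longrightarrow> M \<subseteq> J \<Longrightarrow> J = M" by blast
  then show thesis using that[of M] unfolding S_def by simp
qed

lemma (in cring) ideal_of_closed:
  assumes "I \<subseteq> carrier R" "\<zero> \<in> I" "\<And>a b. a \<in> I \<Longrightarrow> b \<in> I \<Longrightarrow> a \<oplus> b \<in> I"
    and smult: "\<And>a r. a \<in> I \<Longrightarrow> r \<in> carrier R \<Longrightarrow> r \<otimes> a \<in> I"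
  shows "ideal I R"
proof (rule idealI[OF ring_axioms])
  have "\<ominus> a \<in> I" if "a \<in> I" for a
  proof -
    have "a \<in> carrier R" using that assms(1) by blast
    then have "(\<ominus> \<one>) \<otimes> a = \<ominus> a" by algebra
    then show ?thesis using smult[OF that, of "\<ominus> \<one>"] by simp
  qed
  then show "subgroup I (add_monoid R)"
    using assms(1-3) by (intro add.subgroupI) auto
qed (use assms m_comm in fastforce)+

lemma (in ring) ideal_closed:
  assumes "ideal I R"
  shows "\<zero> \<in> I"
    and "a \<in> I \<Longrightarrow> a \<in> carrier R"
    and "\<lbrakk>a \<in> I; b \<in> I\<rbrakk> \<Longrightarrow> a \<oplus> b \<in> I"
    and "\<lbrakk>a \<in> I; b \<in> I\<rbrakk> \<Longrightarrow> a \<ominus> b \<in> I"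
    and "\<lbrakk>a \<in> I; r \<in> carrier R\<rbrakk> \<Longrightarrow> r \<otimes> a \<in> I"
    and "\<lbrakk>a \<in> I; r \<in> carrier R\<rbrakk> \<Longrightarrow> a \<otimes> r \<in> I"
proof -
  interpret ideal I R by fact
  show "\<zero> \<in> I" by simp
  show "a \<in> I \<Longrightarrow> a \<in> carrier R" by (rule Icarr)
  show "\<lbrakk>a \<in> I; b \<in> I\<rbrakk> \<Longrightarrow> a \<oplus> b \<in> I" by simp
  show "\<lbrakk>a \<in> I; b \<in> I\<rbrakk> \<Longrightarrow> a \<ominus> b \<in> I" by (simp add: a_minus_def)
  show "\<lbrakk>a \<in> I; r \<in> carrier R\<rbrakk> \<Longrightarrow> r \<otimes> a \<in> I" by (rule I_l_closed)
  show "\<lbrakk>a \<in> I; r \<in> carrier R\<rbrakk> \<Longrightarrow> a \<otimes> r \<in> I" by (rule I_r_closed)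
qed

definition adjoin :: "('a, 'b) ring_scheme \<Rightarrow> 'a set \<Rightarrow> 'a \<Rightarrow> 'a set"
  where "adjoin R I x = I <+>\<^bsub>R\<^esub> PIdl\<^bsub>R\<^esub> x"

lemma (in cring) adjoin_iff:
  "a \<in> adjoin R I x \<longleftrightarrow> (\<exists>i\<in>I. \<exists>t\<in>carrier R. a = i \<oplus> t \<otimes> x)"
  unfolding adjoin_def set_add_def' cgenideal_def by blast

lemma (in cring) adjoin:
  assumes "ideal I R" "x \<in> carrier R"
  shows "ideal (adjoin R I x) R" "I \<subseteq> adjoin R I x" "x \<in> adjoin R I x"
proof -
  show "ideal (adjoin R I x) R" using assms by (simp add: adjoin_def add_ideals cgenideal_ideal)
  show "I \<subseteq> adjoin R I x"
  proof
    fix a assume "a \<in> I"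
    moreover have "a = a \<oplus> \<zero> \<otimes> x" using assms ideal_closed(2)[OF assms(1) \<open>a \<in> I\<close>] by algebra
    ultimately show "a \<in> adjoin R I x" unfolding adjoin_iff by blast
  qed
  have "x = \<zero> \<oplus> \<one> \<otimes> x" using assms by algebra
  then show "x \<in> adjoin R I x"
    unfolding adjoin_iff using ideal_closed(1)[OF assms(1)] one_closed by blast
qed

lemma (in cring) adjoin_least:
  assumes "ideal D R" "I \<subseteq> D" "x \<in> D"
  shows "adjoin R I x \<subseteq> D"
proof
  fix a assume "a \<in> adjoin R I x"
  then obtain i t where "i \<in> D" "t \<in> carrier R" "a = i \<oplus> t \<otimes> x"
    using assms(2) unfolding adjoin_iff by blast
  then show "a \<in> D" using ideal_closed(3,5)[OF assms(1)] assms(3) by simp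
qed

section \<open>Saturated ideals and a local Nakayama lemma\<close>

text \<open>An ideal is saturated with respect to a prime \<open>P\<close> if it is contracted from the localization at \<open>P\<close>.
Working with saturated ideals of \<open>R\<close> replaces passing to the ring \<open>R\<^sub>P\<close>; likewise all statements are
relative to a smaller prime \<open>Q\<close>, which replaces passing to \<open>R/Q\<close>.\<close>

definition saturated :: "('a, 'b) ring_scheme \<Rightarrow> 'a set \<Rightarrow> 'a set \<Rightarrow> bool"
  where "saturated R P D \<longleftrightarrow>
    (\<forall>s \<in> carrier R - P. \<forall>a \<in> carrier R. s \<otimes>\<^bsub>R\<^esub> a \<in> D \<longrightarrow> a \<in> D)"

definition saturation :: "('a, 'b) ring_scheme \<Rightarrow> 'a set \<Rightarrow> 'a set \<Rightarrow> 'a set"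
  where "saturation R P D = {a \<in> carrier R. \<exists>s \<in> carrier R - P. s \<otimes>\<^bsub>R\<^esub> a \<in> D}"

lemma (in cring) mult_notin_prime:
  assumes "primeideal P R" "s \<in> carrier R - P" "t \<in> carrier R - P"
  shows "s \<otimes> t \<in> carrier R - P"
  using assms primeideal.I_prime[OF assms(1), of s t] by auto

lemma (in cring) one_notin_prime:
  assumes "primeideal P R"
  shows "\<one> \<in> carrier R - P"
  using assms ideal.one_imp_carrier primeideal.I_notcarr primeideal.axioms(1) by fastforce

lemma (in cring) saturation:
  assumes P: "primeideal P R" and D: "ideal D R"
  shows "ideal (saturation R P D) R" "saturated R P (saturation R P D)" "D \<subseteq> saturation R P D"
proof -
  note D' = ideal_closed[OF D]
  show sub: "D \<subseteq> saturation R P D"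
  proof
    fix a assume "a \<in> D"
    then have "\<one> \<otimes> a \<in> D" "a \<in> carrier R" using D'(2) by auto
    then show "a \<in> saturation R P D" using one_notin_prime[OF P] unfolding saturation_def by blast
  qed
  show "ideal (saturation R P D) R"
  proof (rule ideal_of_closed)
    show "saturation R P D \<subseteq> carrier R" unfolding saturation_def by blast
    show "\<zero> \<in> saturation R P D" using sub D'(1) by blast
  next
    fix a b assume "a \<in> saturation R P D" "b \<in> saturation R P D"
    then obtain s t where st: "s \<in> carrier R - P" "t \<in> carrier R - P" "s \<otimes> a \<in> D" "t \<otimes> b \<in> D"
      "a \<in> carrier R" "b \<in> carrier R" unfolding saturation_def by blast
    have "(s \<otimes> t) \<otimes> (a \<oplus> b) = t \<otimes> (s \<otimes> a) \<oplus> s \<otimes> (t \<otimes> b)" using st(1,2,5,6) by simp algebra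
    also have "\<dots> \<in> D" using st D'(3,5) by simp
    finally show "a \<oplus> b \<in> saturation R P D"
      using mult_notin_prime[OF P st(1,2)] st(5,6) unfolding saturation_def by blast
  next
    fix a r assume "a \<in> saturation R P D" and r: "r \<in> carrier R"
    then obtain s where s: "s \<in> carrier R - P" "s \<otimes> a \<in> D" "a \<in> carrier R"
      unfolding saturation_def by blast
    have "s \<otimes> (r \<otimes> a) = r \<otimes> (s \<otimes> a)" using s(1,3) r by simp algebra
    also have "\<dots> \<in> D" using s r D'(5) by simp
    finally show "r \<otimes> a \<in> saturation R P D" using s r unfolding saturation_def by blast
  qed
  show "saturated R P (saturation R P D)"
    unfolding saturated_def
  proof (intro ballI impI)
    fix s a assume s: "s \<in> carrier R - P" and a: "a \<in> carrier R" and "s \<otimes> a \<in> saturation R P D"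
    then obtain t where t: "t \<in> carrier R - P" "t \<otimes> (s \<otimes> a) \<in> D" unfolding saturation_def by blast
    have "(t \<otimes> s) \<otimes> a \<in> D" using s a t by (simp add: m_assoc)
    then show "a \<in> saturation R P D"
      using mult_notin_prime[OF P t(1) s] a unfolding saturation_def by blast
  qed
qed

lemma saturatedD:
  "\<lbrakk>saturated R P D; s \<in> carrier R - P; a \<in> carrier R; s \<otimes>\<^bsub>R\<^esub> a \<in> D\<rbrakk> \<Longrightarrow> a \<in> D"
  unfolding saturated_def by blast

lemma saturationE:
  assumes "a \<in> saturation R P D"
  obtains s where "s \<in> carrier R - P" "s \<otimes>\<^bsub>R\<^esub> a \<in> D" "a \<in> carrier R"
  using assms unfolding saturation_def by blast

locale noetherian_cring = noetherian_ring + cring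

text \<open>Nakayama's lemma for the localization at \<open>P\<close>, applied to \<open>M \<subseteq> N + xM\<close>.
If \<open>M\<close> is not contained in \<open>N\<close>, enlarge \<open>N\<close> to a saturated ideal \<open>N'\<close> that is maximal among those not
containing \<open>M\<close>. Then \<open>x g \<in> N'\<close> for all \<open>g \<in> M\<close>: otherwise the saturation of \<open>N' + (x g)\<close> would contain
\<open>g\<close>, so \<open>(s - t x) g \<in> N'\<close> for some \<open>s\<close> outside \<open>P\<close>, where \<open>s - t x\<close> lies outside \<open>P\<close> as well, and
saturation would give \<open>g \<in> N'\<close>. But \<open>x M \<subseteq> N'\<close> forces \<open>M \<subseteq> N'\<close>.\<close>

lemma (in noetherian_cring) nakayama_saturated:
  assumes P: "primeideal P R" and x: "x \<in> P" and M: "ideal M R"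
    and N: "ideal N R" "saturated R P N"
    and gen: "\<And>a. a \<in> M \<Longrightarrow> \<exists>s\<in>carrier R - P. \<exists>n\<in>N. \<exists>b\<in>M. s \<otimes> a = n \<oplus> x \<otimes> b"
  shows "M \<subseteq> N"
proof (rule ccontr)
  assume "\<not> M \<subseteq> N"
  define \<Phi> where "\<Phi> J \<longleftrightarrow> saturated R P J \<and> N \<subseteq> J \<and> \<not> M \<subseteq> J" for J
  have "\<Phi> N" using N(2) \<open>\<not> M \<subseteq> N\<close> unfolding \<Phi>_def by simp
  then obtain N' where N': "ideal N' R" and "\<Phi> N'"
    and max: "\<And>J. ideal J R \<Longrightarrow> \<Phi> J \<Longrightarrow> N' \<subseteq> J \<Longrightarrow> J = N'"
    using exists_maximal_ideal_with[OF N(1), of \<Phi>] by metis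
  have satN': "saturated R P N'" and NN': "N \<subseteq> N'" and MN': "\<not> M \<subseteq> N'"
    using \<open>\<Phi> N'\<close> unfolding \<Phi>_def by simp_all
  note M' = ideal_closed[OF M] and N'' = ideal_closed[OF N']
    and P' = ideal_closed[OF primeideal.axioms(1)[OF P]]
  have xM: "x \<otimes> g \<in> N'" if g: "g \<in> M" for g
  proof (rule ccontr)
    assume notin: "x \<otimes> g \<notin> N'"
    have carr: "x \<in> carrier R" "g \<in> carrier R" "x \<otimes> g \<in> carrier R" using P'(2)[OF x] M'(2)[OF g] by auto
    define D where "D = saturation R P (adjoin R N' (x \<otimes> g))"
    note add = adjoin[OF N' carr(3)]
    note sat = saturation[OF P add(1), folded D_def]
    have "D \<noteq> N'" "N' \<subseteq> D" using notin sat(3) add(2,3) by auto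
    then have "\<not> \<Phi> D" using max sat(1) by blast
    then have "M \<subseteq> D" using sat(2) NN' \<open>N' \<subseteq> D\<close> unfolding \<Phi>_def by auto
    then have "g \<in> D" using g by blast
    then obtain s where s: "s \<in> carrier R - P" "s \<otimes> g \<in> adjoin R N' (x \<otimes> g)"
      unfolding D_def by (rule saturationE)
    then obtain n t where nt: "n \<in> N'" "t \<in> carrier R" "s \<otimes> g = n \<oplus> t \<otimes> (x \<otimes> g)"
      unfolding adjoin_iff by blast
    have sc: "s \<in> carrier R" using s(1) by simp
    have n: "n \<in> carrier R" using N''(2)[OF nt(1)] .
    have "(s \<ominus> t \<otimes> x) \<otimes> g = s \<otimes> g \<ominus> t \<otimes> (x \<otimes> g)" using sc nt(2) carr(1,2) by algebra
    moreover have "(n \<oplus> t \<otimes> (x \<otimes> g)) \<ominus> t \<otimes> (x \<otimes> g) = n" using n nt(2) carr(1,2) by algebra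
    ultimately have eq: "(s \<ominus> t \<otimes> x) \<otimes> g \<in> N'" using nt(1,3) by simp
    have "s \<ominus> t \<otimes> x \<notin> P"
    proof
      assume "s \<ominus> t \<otimes> x \<in> P"
      then have "(s \<ominus> t \<otimes> x) \<oplus> t \<otimes> x \<in> P" using P'(3) P'(5)[OF x nt(2)] by simp
      moreover have "(s \<ominus> t \<otimes> x) \<oplus> t \<otimes> x = s" using sc nt(2) carr by algebra
      ultimately show False using s(1) by simp
    qed
    then have "g \<in> N'" using saturatedD[OF _ _ carr(2) eq, of P] satN' s(1) nt(2) carr by simp
    then show False using notin N''(5)[OF _ carr(1)] by simp
  qed
  have "M \<subseteq> N'"
  proof
    fix a assume a: "a \<in> M"
    then obtain s n b where s: "s \<in> carrier R - P" "n \<in> N" "b \<in> M" "s \<otimes> a = n \<oplus> x \<otimes> b"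
      using gen by blast
    then have "s \<otimes> a \<in> N'" using N''(3)[of n "x \<otimes> b"] NN' xM by auto
    then show "a \<in> N'" using saturatedD[of R P N' s a] satN' s(1) M'(2)[OF a] by simp
  qed
  then show False using MN' by simp
qed

section \<open>Krull's principal ideal theorem\<close>

text \<open>If \<open>P\<close> is minimal over \<open>C0\<close>, then \<open>R\<^sub>P / C0 R\<^sub>P\<close> is Artinian; the lemma says so in terms of saturated
ideals of \<open>R\<close>. Take an ideal \<open>C\<close> that is maximal among those over which the chain condition fails.
It is prime: if \<open>a b \<in> C\<close> with \<open>a, b \<notin> C\<close>, the condition holds over \<open>C + (a)\<close> and over \<open>C : a\<close>, and a
chain \<open>E\<close> is determined by the chains \<open>E + (a)\<close> and \<open>E : a\<close>. Moreover \<open>C \<subseteq> P\<close>, because a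
saturated ideal that meets the complement of \<open>P\<close> is all of \<open>R\<close>. By minimality \<open>C = P\<close>, and the
only saturated ideals above \<open>P\<close> are \<open>P\<close> and \<open>R\<close>.\<close>

lemma (in noetherian_cring) saturated_chain_stationary:
  assumes P: "primeideal P R" and C0: "ideal C0 R"
    and minimal: "\<And>P'. primeideal P' R \<Longrightarrow> C0 \<subseteq> P' \<Longrightarrow> P' \<subseteq> P \<Longrightarrow> P' = P"
    and D: "\<And>n. ideal (D n) R" "\<And>n. saturated R P (D n)" "\<And>n. C0 \<subseteq> D n" "\<And>n. D (Suc n) \<subseteq> D n"
  shows "\<exists>n. \<forall>k\<ge>n. D k = D n"
proof (rule ccontr)
  assume neg: "\<not> ?thesis"
  define adm where "adm C E \<longleftrightarrow> (\<forall>n. ideal (E n) R \<and> saturated R P (E n) \<and> C \<subseteq> E n \<and> E (Suc n) \<subseteq> E n)"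
    for C and E :: "nat \<Rightarrow> 'a set"
  define stat where "stat E \<longleftrightarrow> (\<exists>n. \<forall>k\<ge>n. E k = E n)" for E :: "nat \<Rightarrow> 'a set"
  define bad where "bad C \<longleftrightarrow> C0 \<subseteq> C \<and> (\<exists>E. adm C E \<and> \<not> stat E)" for C
  have "bad C0" using D neg unfolding bad_def adm_def stat_def by (intro conjI exI[of _ D]) auto
  then obtain C where C: "ideal C R" and bad: "bad C"
    and max: "\<And>J. ideal J R \<Longrightarrow> bad J \<Longrightarrow> C \<subseteq> J \<Longrightarrow> J = C"
    using exists_maximal_ideal_with[OF C0, of bad] by metis
  from bad obtain E where E: "adm C E" and nstat: "\<not> stat E" and C0C: "C0 \<subseteq> C"
    unfolding bad_def by blast
  have Eid: "\<And>n. ideal (E n) R" and Esat: "\<And>n. saturated R P (E n)" and CE: "\<And>n. C \<subseteq> E n"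
    and Edec: "\<And>n. E (Suc n) \<subseteq> E n"
    using E unfolding adm_def by auto
  have anti: "E k \<subseteq> E n" if "n \<le> k" for n k
    using that by (rule lift_Suc_antimono_le[of E, OF Edec])
  have statI: "stat F" if "ideal J R" "C \<subseteq> J" "J \<noteq> C" "adm J F" for J F
    using max[OF that(1)] that C0C unfolding bad_def by blast
  have full: "E n = carrier R" if "s \<in> E n" "s \<in> carrier R - P" for s n
  proof -
    have "\<one> \<in> E n" using saturatedD[OF Esat that(2), of \<one> n] that by simp
    then show ?thesis using ideal.one_imp_carrier[OF Eid] by blast
  qed
  have nstat': False if "\<And>n. E n = E 0"
    using nstat that unfolding stat_def by metis
  have CP: "C \<subseteq> P"
  proof (rule ccontr)
    assume "\<not> C \<subseteq> P"
    then obtain s where "s \<in> C" "s \<in> carrier R - P" using ideal_closed(2)[OF C] by blast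
    then have "E n = carrier R" for n using full[of s n] CE[of n] by blast
    then show False using nstat' by simp
  qed
  have "primeideal C R"
  proof (rule primeidealI[OF C is_cring])
    show "carrier R \<noteq> C" using CP one_notin_prime[OF P] by blast
    fix a b assume a: "a \<in> carrier R" and b: "b \<in> carrier R" and ab: "a \<otimes> b \<in> C"
    show "a \<in> C \<or> b \<in> C"
    proof (rule ccontr)
      assume nab: "\<not> (a \<in> C \<or> b \<in> C)"
      define colon where "colon J = {t \<in> carrier R. a \<otimes> t \<in> J}" for J
      have colon: "ideal (colon J) R" "J \<subseteq> colon J" if J: "ideal J R" for J
      proof -
        note J' = ideal_closed[OF J]
        show "ideal (colon J) R"
        proof (rule ideal_of_closed)
          fix t u assume "t \<in> colon J" "u \<in> colon J"
          then show "t \<oplus> u \<in> colon J" using a J'(3) unfolding colon_def by (simp add: r_distr)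
        next
          fix t r assume "t \<in> colon J" and r: "r \<in> carrier R"
          then have "a \<otimes> (r \<otimes> t) = r \<otimes> (a \<otimes> t)" "t \<in> carrier R" "a \<otimes> t \<in> J"
            using a unfolding colon_def by (simp_all add: m_lcomm)
          then show "r \<otimes> t \<in> colon J" using a r J'(5) unfolding colon_def by simp
        qed (use a J'(1) in \<open>auto simp: colon_def\<close>)
        show "J \<subseteq> colon J" using a J'(2,5) unfolding colon_def by blast
      qed
      define F where "F n = saturation R P (adjoin R (E n) a)" for n
      have "stat F"
      proof (rule statI)
        show "ideal (adjoin R C a) R" "C \<subseteq> adjoin R C a" using adjoin[OF C a] by auto
        show "adjoin R C a \<noteq> C" using adjoin(3)[OF C a] nab by blast
        show "adm (adjoin R C a) F"
          unfolding adm_def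
        proof (intro allI conjI)
          fix n
          note F' = saturation[OF P adjoin(1)[OF Eid a], folded F_def]
          show "ideal (F n) R" "saturated R P (F n)" by (rule F')+
          have "adjoin R C a \<subseteq> adjoin R (E n) a"
            using CE unfolding adjoin_def set_add_def' by blast
          then show "adjoin R C a \<subseteq> F n" using F'(3) by blast
          have "adjoin R (E (Suc n)) a \<subseteq> adjoin R (E n) a"
            using Edec[of n] unfolding adjoin_def set_add_def' by blast
          then show "F (Suc n) \<subseteq> F n" unfolding F_def saturation_def by blast
        qed
      qed
      moreover have "stat (\<lambda>n. colon (E n))"
      proof (rule statI)
        show "ideal (colon C) R" "C \<subseteq> colon C" using colon[OF C] by auto
        show "colon C \<noteq> C" using nab ab b unfolding colon_def by blast
        show "adm (colon C) (\<lambda>n. colon (E n))"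
          unfolding adm_def
        proof (intro allI conjI)
          fix n
          show "ideal (colon (E n)) R" using colon[OF Eid] by simp
          show "colon C \<subseteq> colon (E n)" "colon (E (Suc n)) \<subseteq> colon (E n)"
            using CE Edec unfolding colon_def by blast+
          show "saturated R P (colon (E n))"
            unfolding saturated_def
          proof (intro ballI impI)
            fix s t assume s: "s \<in> carrier R - P" and t: "t \<in> carrier R" and "s \<otimes> t \<in> colon (E n)"
            then have "s \<otimes> (a \<otimes> t) \<in> E n" using a unfolding colon_def by (simp add: m_lcomm)
            then have "a \<otimes> t \<in> E n" using saturatedD[OF Esat s] a t by simp
            then show "t \<in> colon (E n)" using t unfolding colon_def by simp
          qed
        qed
      qed
      ultimately obtain n1 n2 where n1: "\<forall>k\<ge>n1. F k = F n1" and n2: "\<forall>k\<ge>n2. colon (E k) = colon (E n2)"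
        unfolding stat_def by blast
      define n where "n = max n1 n2"
      have eqF: "F k = F n" and eqc: "colon (E k) = colon (E n)" if "n \<le> k" for k
        using n1 n2 that unfolding n_def by (metis max.boundedE max.cobounded1 max.cobounded2)+
      have "E n \<subseteq> E k" if nk: "n \<le> k" for k
      proof
        fix y assume y: "y \<in> E n"
        have yc: "y \<in> carrier R" using ideal_closed(2)[OF Eid y] .
        have "y \<in> F n"
          using y adjoin(2)[OF Eid a] saturation(3)[OF P adjoin(1)[OF Eid a]] unfolding F_def by blast
        then have "y \<in> F k" using eqF[OF nk] by simp
        then obtain s where s: "s \<in> carrier R - P" "s \<otimes> y \<in> adjoin R (E k) a"
          unfolding F_def by (rule saturationE)
        then obtain d t where d: "d \<in> E k" and t: "t \<in> carrier R" and sy: "s \<otimes> y = d \<oplus> t \<otimes> a"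
          unfolding adjoin_iff by blast
        have dn: "d \<in> E n" and dc: "d \<in> carrier R"
          using d anti[OF nk] ideal_closed(2)[OF Eid d] by auto
        have "s \<otimes> y \<in> E n" using ideal_closed(5)[OF Eid y] s(1) by simp
        then have "s \<otimes> y \<ominus> d \<in> E n" using ideal_closed(4)[OF Eid _ dn] by simp
        moreover have "(d \<oplus> t \<otimes> a) \<ominus> d = a \<otimes> t" using dc a t by algebra
        ultimately have "t \<in> colon (E n)" using sy t unfolding colon_def by simp
        then have "t \<in> colon (E k)" using eqc[OF nk] by simp
        then have "a \<otimes> t \<in> E k" unfolding colon_def by simp
        then have "d \<oplus> t \<otimes> a \<in> E k" using ideal_closed(3)[OF Eid d] m_comm[OF a t] by simp
        then show "y \<in> E k" using saturatedD[OF Esat s(1) yc] sy by simp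
      qed
      then have "\<forall>k\<ge>n. E k = E n" using anti by blast
      then show False using nstat unfolding stat_def by blast
    qed
  qed
  then have "C = P" using minimal C0C CP by blast
  have dich: "E n = P \<or> E n = carrier R" for n
    using full[of _ n] CE[of n] \<open>C = P\<close> ideal_closed(2)[OF Eid, of _ n] by blast
  show False
  proof (cases "\<exists>m. E m = P")
    case True
    then obtain m where m: "E m = P" by blast
    have "E k = P" if "m \<le> k" for k using anti[OF that] m CE[of k] \<open>C = P\<close> by blast
    then show False using nstat m unfolding stat_def by blast
  next
    case False
    then show False using dich nstat' by metis
  qed
qed

text \<open>The form of Krull's principal ideal theorem that is needed for exchanging primes in chains.
Suppose \<open>x \<notin> P'\<close> and that \<open>P\<close> is minimal over \<open>Q + (x)\<close>. Choose \<open>y \<in> P'\<close> outside \<open>Q\<close> and let \<open>T n\<close> be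
the \<open>P'\<close>-saturation of \<open>Q + (y\<^sup>n)\<close>, an analogue of a symbolic power. The \<open>P\<close>-saturations of
\<open>T n + (x)\<close> become stationary, so \<open>T n \<subseteq> T (n+1) + x T n\<close> up to factors outside \<open>P\<close> (an element of
\<open>T n\<close> that is a multiple of \<open>x\<close> is \<open>x\<close> times an element of \<open>T n\<close>, because \<open>x \<notin> P'\<close>). Nakayama gives
\<open>T n = T (n+1)\<close>. Hence \<open>(s - t y) y\<^sup>n \<in> Q\<close> with \<open>s \<notin> P'\<close>, so that \<open>s - t y \<notin> Q\<close> and \<open>y \<in> Q\<close>,
a contradiction.\<close>

theorem (in noetherian_cring) prime_between_containing:
  assumes Q: "primeideal Q R" and P': "primeideal P' R" and P: "primeideal P R"
    and QP': "Q \<subset> P'" and P'P: "P' \<subset> P" and x: "x \<in> P"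
  obtains P'' where "primeideal P'' R" "Q \<subset> P''" "P'' \<subset> P" "x \<in> P''"
proof (cases "x \<in> P'")
  case True
  then show thesis using that[of P'] assms by simp
next
  case xP': False
  note Pid = primeideal.axioms(1)[OF P] and Qid = primeideal.axioms(1)[OF Q]
    and P'id = primeideal.axioms(1)[OF P']
  have xc: "x \<in> carrier R" using ideal_closed(2)[OF Pid x] .
  note adj = adjoin[OF Qid xc]
  have "\<exists>P''. primeideal P'' R \<and> adjoin R Q x \<subseteq> P'' \<and> P'' \<subseteq> P \<and> P'' \<noteq> P"
  proof (rule ccontr)
    assume "\<not> ?thesis"
    then have minimal: "\<And>P''. primeideal P'' R \<Longrightarrow> adjoin R Q x \<subseteq> P'' \<Longrightarrow> P'' \<subseteq> P \<Longrightarrow> P'' = P"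
      by blast
    obtain y where y: "y \<in> P'" "y \<notin> Q" using QP' by blast
    have yc: "y \<in> carrier R" using ideal_closed(2)[OF P'id y(1)] .
    define T where "T n = saturation R P' (adjoin R Q (y [^] (n::nat)))" for n
    have ync: "y [^] n \<in> carrier R" for n :: nat using yc by simp
    note T = saturation[OF P' adjoin(1)[OF Qid ync], folded T_def]
    have T_dec: "T (Suc n) \<subseteq> T n" for n
    proof -
      have "y [^] Suc n \<in> adjoin R Q (y [^] n)"
        using ideal_closed(6)[OF adjoin(1)[OF Qid ync] adjoin(3)[OF Qid ync] yc] by simp
      then have "adjoin R Q (y [^] Suc n) \<subseteq> adjoin R Q (y [^] n)"
        using adjoin_least[OF adjoin(1)[OF Qid ync] adjoin(2)[OF Qid ync]] by blast
      then show ?thesis unfolding T_def saturation_def by blast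
    qed
    define D where "D n = saturation R P (adjoin R (T n) x)" for n
    note D = saturation[OF P adjoin(1)[OF T(1) xc], folded D_def]
    have QT: "Q \<subseteq> T n" for n using T(3)[of n] adjoin(2)[OF Qid ync] by blast
    have "\<exists>n. \<forall>k\<ge>n. D k = D n"
    proof (rule saturated_chain_stationary[OF P adj(1) minimal])
      fix n
      show "ideal (D n) R" "saturated R P (D n)" by (rule D)+
      show "adjoin R Q x \<subseteq> D n"
        using adjoin_least[OF adjoin(1)[OF T(1)[of n] xc], of Q x] QT[of n]
          adjoin(2,3)[OF T(1)[of n] xc] D(3)[of n]
        by blast
      have "adjoin R (T (Suc n)) x \<subseteq> adjoin R (T n) x"
        using T_dec[of n] unfolding adjoin_def set_add_def' by blast
      then show "D (Suc n) \<subseteq> D n" unfolding D_def saturation_def by blast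
    qed
    then obtain n where n: "D (Suc n) = D n" by (metis le_Suc_eq order_refl)
    have "T n \<subseteq> T (Suc n)"
    proof (rule nakayama_saturated[OF P x T(1,1)])
      show "saturated R P (T (Suc n))"
        using T(2)[of "Suc n"] P'P unfolding saturated_def by blast
      fix a assume a: "a \<in> T n"
      then have "a \<in> D (Suc n)" using n adjoin(2)[OF T(1)[of n] xc] D(3)[of n] by blast
      then obtain s where s: "s \<in> carrier R - P" "s \<otimes> a \<in> adjoin R (T (Suc n)) x"
        unfolding D_def by (rule saturationE)
      then obtain b t where b: "b \<in> T (Suc n)" and t: "t \<in> carrier R" and sa: "s \<otimes> a = b \<oplus> t \<otimes> x"
        unfolding adjoin_iff by blast
      have bn: "b \<in> T n" and bc: "b \<in> carrier R" using b T_dec[of n] ideal_closed(2)[OF T(1) b] by auto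
      have "s \<otimes> a \<ominus> b \<in> T n" using ideal_closed(4,5)[OF T(1)] a bn s(1) by simp
      moreover have "(b \<oplus> t \<otimes> x) \<ominus> b = x \<otimes> t" using bc t xc by algebra
      ultimately have "x \<otimes> t \<in> T n" using sa by simp
      then have "t \<in> T n" using saturatedD[OF T(2) _ t, of x n] xc xP' by simp
      moreover have "s \<otimes> a = b \<oplus> x \<otimes> t" using sa m_comm[OF xc t] by simp
      ultimately show "\<exists>s\<in>carrier R - P. \<exists>n'\<in>T (Suc n). \<exists>b\<in>T n. s \<otimes> a = n' \<oplus> x \<otimes> b"
        using s(1) b by blast
    qed
    moreover have "y [^] n \<in> T n" using adjoin(3)[OF Qid ync] T(3) by blast
    ultimately have "y [^] n \<in> T (Suc n)" by blast
    then obtain s where s: "s \<in> carrier R - P'" "s \<otimes> y [^] n \<in> adjoin R Q (y [^] Suc n)"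
      unfolding T_def by (rule saturationE)
    then obtain q t where q: "q \<in> Q" and t: "t \<in> carrier R" and eq: "s \<otimes> y [^] n = q \<oplus> t \<otimes> y [^] Suc n"
      unfolding adjoin_iff by blast
    have qc: "q \<in> carrier R" and sc: "s \<in> carrier R" using ideal_closed(2)[OF Qid q] s(1) by auto
    have tyc: "t \<otimes> y \<in> P'" using ideal_closed(5)[OF P'id y(1) t] .
    have "(s \<ominus> t \<otimes> y) \<otimes> z = s \<otimes> z \<ominus> t \<otimes> (z \<otimes> y)" "(q \<oplus> t \<otimes> (z \<otimes> y)) \<ominus> t \<otimes> (z \<otimes> y) = q"
      if "z \<in> carrier R" for z using sc t yc qc that by algebra+
    from this[OF ync[of n]] have "(s \<ominus> t \<otimes> y) \<otimes> y [^] n = q" using eq by simp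
    then have "(s \<ominus> t \<otimes> y) \<otimes> y [^] n \<in> Q" using q by simp
    moreover have "s \<ominus> t \<otimes> y \<notin> P'"
    proof
      assume "s \<ominus> t \<otimes> y \<in> P'"
      then have "(s \<ominus> t \<otimes> y) \<oplus> t \<otimes> y \<in> P'" using ideal_closed(3)[OF P'id _ tyc] by simp
      moreover have "(s \<ominus> t \<otimes> y) \<oplus> t \<otimes> y = s" using sc t yc by algebra
      ultimately show False using s(1) by simp
    qed
    ultimately have "y [^] n \<in> Q"
      using primeideal.I_prime[OF Q, of "s \<ominus> t \<otimes> y" "y [^] n"] QP' sc t yc by auto
    moreover have "y [^] n \<notin> Q" for n :: nat
    proof (induction n)
      case 0
      then show ?case using one_notin_prime[OF Q] by simp
    next
      case (Suc n)
      then show ?case using primeideal.I_prime[OF Q ync yc, of n] y(2) by auto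
    qed
    ultimately show False by blast
  qed
  then obtain P'' where P'': "primeideal P'' R" "adjoin R Q x \<subseteq> P''" "P'' \<subseteq> P" "P'' \<noteq> P" by blast
  have "x \<in> P''" "Q \<subseteq> P''" using adj(2,3) P''(2) by auto
  moreover have "x \<notin> Q" using xP' QP' by blast
  ultimately show thesis using that[of P''] P'' by blast
qed


text \<open>Killing \<open>z\<close> lowers the length of a chain of primes by at most one. From the top downwards, each inner
prime is replaced by one that contains \<open>z\<close> and lies strictly between its neighbours.\<close>

lemma (in noetherian_cring) prime_chain_through:
  assumes "prime_chain R (Suc e) P" "z \<in> P (Suc e)"
  obtains Q where "prime_chain R e Q" "Q e = P (Suc e)" "P 0 \<subset> Q 0" "z \<in> Q 0"
proof -
  have "\<exists>Q. prime_chain R e Q \<and> Q e = P (Suc e) \<and> P 0 \<subset> Q 0 \<and> z \<in> Q 0"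
    using assms
  proof (induction e arbitrary: P)
    case 0
    then show ?case by (intro exI[of _ "\<lambda>_. P (Suc 0)"]) (auto simp: prime_chain_def)
  next
    case (Suc e)
    have prime: "\<And>i. i \<le> Suc (Suc e) \<Longrightarrow> primeideal (P i) R"
      and strict: "\<And>i. i < Suc (Suc e) \<Longrightarrow> P i \<subset> P (Suc i)"
      using Suc.prems(1) unfolding prime_chain_def by auto
    obtain P' where P': "primeideal P' R" "P e \<subset> P'" "P' \<subset> P (Suc (Suc e))" "z \<in> P'"
      using prime_between_containing[OF prime[of e] prime[of "Suc e"] prime[of "Suc (Suc e)"]
          strict[of e] strict[of "Suc e"] Suc.prems(2)] by auto
    have "prime_chain R (Suc e) (P(Suc e := P'))"
      unfolding prime_chain_def
    proof (intro conjI allI impI)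
      fix i assume "i \<le> Suc e" then show "primeideal ((P(Suc e := P')) i) R" using prime P'(1) by auto
    next
      fix i assume "i < Suc e" then show "(P(Suc e := P')) i \<subset> (P(Suc e := P')) (Suc i)"
        using strict[of i] P'(2) by (cases "i = e") auto
    qed
    from Suc.IH[OF this] P'(4) obtain Q
      where Q: "prime_chain R e Q" "Q e = P'" "P 0 \<subset> Q 0" "z \<in> Q 0" by auto
    have "prime_chain R (Suc e) (Q(Suc e := P (Suc (Suc e))))"
      unfolding prime_chain_def
    proof (intro conjI allI impI)
      fix i assume "i \<le> Suc e"
      then show "primeideal ((Q(Suc e := P (Suc (Suc e)))) i) R"
        using prime Q(1) by (auto simp: prime_chain_def)
    next
      fix i assume "i < Suc e"
      then show "(Q(Suc e := P (Suc (Suc e)))) i \<subset> (Q(Suc e := P (Suc (Suc e)))) (Suc i)"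
        using Q(1,2) P'(3) by (cases "i = e") (auto simp: prime_chain_def)
    qed
    then show ?case
      using Q(3,4) by (intro exI[of _ "Q(Suc e := P (Suc (Suc e)))"] conjI) (assumption | simp)+
  qed
  then show thesis using that by blast
qed

section \<open>Powers of ideals\<close>

abbreviation (in cring) power_of_ideal :: "'a set \<Rightarrow> nat \<Rightarrow> 'a set" (infixr \<open>\<up>\<close> 90)
  where "I \<up> n \<equiv> ideal_pow R I n"

lemma (in cring) ideal_pow_0: "I \<up> 0 = carrier R"
  by (simp add: ideal_pow_def ideals_set_def nat_pow_def)

lemma (in cring) ideal_pow_Suc: "I \<up> Suc n = (I \<up> n) \<cdot> I"
  by (simp add: ideal_pow_def ideals_set_def nat_pow_def)

lemma (in cring) ideal_ideal_pow:
  assumes "ideal I R"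
  shows "ideal (I \<up> n) R"
  by (induction n) (simp_all add: ideal_pow_0 ideal_pow_Suc oneideal ideal_prod_is_ideal assms)

lemma (in cring) ideal_pow_1:
  assumes "ideal I R"
  shows "I \<up> Suc 0 = I"
  using ideal_prod_commute[OF oneideal assms] ideal_prod_one[OF assms]
  by (simp add: ideal_pow_0 ideal_pow_Suc)

lemma (in cring) ideal_pow_Suc':
  assumes "ideal I R"
  shows "I \<up> Suc n = I \<cdot> (I \<up> n)"
  unfolding ideal_pow_Suc by (rule ideal_prod_commute[OF ideal_ideal_pow[OF assms] assms])

lemma (in cring) ideal_pow_Suc_subset:
  assumes "ideal I R"
  shows "I \<up> Suc n \<subseteq> I \<up> n"
  using ideal_prod_inter[OF ideal_ideal_pow[OF assms] assms] by (auto simp: ideal_pow_Suc)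

lemma (in cring) ideal_prod_subset_ideal:
  assumes "ideal D R" "\<And>a b. a \<in> A \<Longrightarrow> b \<in> B \<Longrightarrow> a \<otimes> b \<in> D"
  shows "A \<cdot> B \<subseteq> D"
proof
  fix c assume "c \<in> A \<cdot> B"
  then show "c \<in> D"
    by induction (use assms(2) ideal_closed(3)[OF assms(1)] in auto)
qed

lemma (in cring) ideal_prod_mono:
  assumes "A \<subseteq> A'" "B \<subseteq> B'"
  shows "A \<cdot> B \<subseteq> A' \<cdot> B'"
proof
  fix c assume "c \<in> A \<cdot> B"
  then show "c \<in> A' \<cdot> B'"
    by induction (use assms in \<open>auto intro: ideal_prod.intros\<close>)
qed

lemma (in cring) ideal_pow_mono:
  assumes "I \<subseteq> J"
  shows "I \<up> n \<subseteq> J \<up> n"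
  by (induction n) (simp_all add: ideal_pow_0 ideal_pow_Suc ideal_prod_mono assms)

lemma (in cring) ideal_pow_mult:
  assumes "ideal I R"
  shows "a \<in> I \<up> k \<Longrightarrow> b \<in> I \<up> l \<Longrightarrow> a \<otimes> b \<in> I \<up> (k + l)"
proof -
  have "I \<up> (k + l) = I \<up> k \<cdot> I \<up> l"
  proof (induction l)
    case 0
    then show ?case by (simp add: ideal_pow_0 ideal_prod_one ideal_ideal_pow assms)
  next
    case (Suc l)
    then show ?case by (simp add: ideal_pow_Suc ideal_prod_assoc ideal_ideal_pow assms)
  qed
  then show "a \<in> I \<up> k \<Longrightarrow> b \<in> I \<up> l \<Longrightarrow> a \<otimes> b \<in> I \<up> (k + l)"
    using ideal_prod.prod[of a _ b] by simp
qed

lemma (in cring) ideal_prod_pow_mult: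
  assumes Q: "ideal Q R" and I: "ideal I R" and a: "a \<in> Q \<cdot> I \<up> k" and b: "b \<in> I \<up> l"
  shows "a \<otimes> b \<in> Q \<cdot> I \<up> (k + l)"
  using a
proof induction
  case (prod q u)
  have "q \<in> carrier R" "u \<in> carrier R" "b \<in> carrier R"
    using prod ideal_closed(2)[OF Q] b ideal_closed(2)[OF ideal_ideal_pow[OF I]] by blast+
  then have "(q \<otimes> u) \<otimes> b = q \<otimes> (u \<otimes> b)" by (simp add: m_assoc)
  then show ?case using ideal_prod.prod[OF prod(1) ideal_pow_mult[OF I prod(2) b]] by simp
next
  case (sum s t)
  have sub: "Q \<cdot> I \<up> k \<subseteq> carrier R" using ideal_prod_in_carrier[OF Q ideal_ideal_pow[OF I]] .
  have "(s \<oplus> t) \<otimes> b = s \<otimes> b \<oplus> t \<otimes> b"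
    using sum(1,2) sub ideal_closed(2)[OF ideal_ideal_pow[OF I] b] by (intro l_distr) auto
  then show ?case using ideal_prod.sum[OF sum(3,4)] by simp
qed

lemma (in cring) ideal_add_multiples:
  assumes A: "ideal A R" and B: "ideal B R" and x: "x \<in> carrier R"
  shows "ideal {a \<oplus> x \<otimes> b | a b. a \<in> A \<and> b \<in> B} R" (is "ideal ?D R")
proof (rule ideal_of_closed)
  note A' = ideal_closed[OF A] and B' = ideal_closed[OF B]
  show "?D \<subseteq> carrier R" using A'(2) B'(2) x by auto
  have "\<zero> = \<zero> \<oplus> x \<otimes> \<zero>" using x by simp
  then show "\<zero> \<in> ?D" using A'(1) B'(1) by blast
  fix u v assume "u \<in> ?D" "v \<in> ?D"
  then obtain a b c d where *: "a \<in> A" "b \<in> B" "c \<in> A" "d \<in> B" "u = a \<oplus> x \<otimes> b" "v = c \<oplus> x \<otimes> d"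
    by blast
  have "u \<oplus> v = (a \<oplus> c) \<oplus> x \<otimes> (b \<oplus> d)"
    unfolding *(5,6) using x A'(2)[OF *(1)] A'(2)[OF *(3)] B'(2)[OF *(2)] B'(2)[OF *(4)] by algebra
  then show "u \<oplus> v \<in> ?D" using A'(3)[OF *(1,3)] B'(3)[OF *(2,4)] by blast
next
  note A' = ideal_closed[OF A] and B' = ideal_closed[OF B]
  fix u r assume "u \<in> ?D" and r: "r \<in> carrier R"
  then obtain a b where *: "a \<in> A" "b \<in> B" "u = a \<oplus> x \<otimes> b"
    by blast
  have "r \<otimes> u = r \<otimes> a \<oplus> x \<otimes> (r \<otimes> b)"
    unfolding *(3) using x r A'(2)[OF *(1)] B'(2)[OF *(2)] by algebra
  then show "r \<otimes> u \<in> ?D" using A'(5)[OF *(1) r] B'(5)[OF *(2) r] by blast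
qed

text \<open>With \<open>J = I + (x)\<close> this is \<open>J\<^bsup>n+1\<^esup> \<subseteq> I\<^bsup>n+1\<^esup> + x J\<^sup>n\<close>: an element of \<open>J\<^bsup>n+1\<^esup>\<close> is a polynomial in
\<open>x\<close> whose coefficients lie in the complementary powers of \<open>I\<close>, and its constant term is split off.\<close>

lemma (in cring) adjoin_pow_decomp:
  assumes I: "ideal I R" and x: "x \<in> carrier R" and c: "c \<in> adjoin R I x \<up> Suc n"
  obtains a b where "a \<in> I \<up> Suc n" "b \<in> adjoin R I x \<up> n" "c = a \<oplus> x \<otimes> b"
proof -
  define J where "J = adjoin R I x"
  have J: "ideal J R" "I \<subseteq> J" "x \<in> J" using adjoin[OF I x] unfolding J_def by auto
  note Jn = ideal_ideal_pow[OF J(1)] and In = ideal_ideal_pow[OF I]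
  define D where "D n = {a \<oplus> x \<otimes> b | a b. a \<in> I \<up> Suc n \<and> b \<in> J \<up> n}" for n
  have "J \<up> Suc n \<subseteq> D n" for n
  proof (induction n)
    case 0
    have "c \<in> D 0" if cJ: "c \<in> J" for c
    proof -
      obtain i t where "i \<in> I" "t \<in> carrier R" "c = i \<oplus> t \<otimes> x"
        using cJ unfolding J_def adjoin_iff by blast
      then show ?thesis using x m_comm[of t x] unfolding D_def ideal_pow_1[OF I] ideal_pow_0 by auto
    qed
    then show ?case using ideal_pow_1[OF J(1)] by blast
  next
    case (Suc n)
    have D: "ideal (D (Suc n)) R" unfolding D_def by (rule ideal_add_multiples[OF In Jn x])
    show ?case
      unfolding ideal_pow_Suc[of J "Suc n"]
    proof (rule ideal_prod_subset_ideal[OF D])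
      fix u v assume u: "u \<in> J \<up> Suc n" and "v \<in> J"
      then obtain i t where i: "i \<in> I" and t: "t \<in> carrier R" and v: "v = i \<oplus> t \<otimes> x"
        unfolding J_def adjoin_iff by blast
      obtain a b where a: "a \<in> I \<up> Suc n" and b: "b \<in> J \<up> n" and u': "u = a \<oplus> x \<otimes> b"
        using Suc.IH u unfolding D_def by blast
      have ai: "a \<otimes> i \<in> I \<up> Suc (Suc n)"
        unfolding ideal_pow_Suc[of I "Suc n"] using a i by (rule ideal_prod.prod)
      have bi: "b \<otimes> i \<in> J \<up> Suc n"
        unfolding ideal_pow_Suc[of J n] using b i J(2) by (auto intro: ideal_prod.prod)
      have uc: "u \<in> carrier R" and ac: "a \<in> carrier R" and bc: "b \<in> carrier R" and ic: "i \<in> carrier R"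
        using ideal_closed(2)[OF Jn u] ideal_closed(2)[OF In a] ideal_closed(2)[OF Jn b]
          ideal_closed(2)[OF I i] by auto
      have "u \<otimes> v = u \<otimes> i \<oplus> x \<otimes> (t \<otimes> u)" unfolding v using uc ic t x by algebra
      also have "u \<otimes> i = a \<otimes> i \<oplus> x \<otimes> (b \<otimes> i)" unfolding u' using ac bc ic x by algebra
      also have "a \<otimes> i \<oplus> x \<otimes> (b \<otimes> i) \<oplus> x \<otimes> (t \<otimes> u) = a \<otimes> i \<oplus> x \<otimes> (b \<otimes> i \<oplus> t \<otimes> u)"
        using ac bc ic t uc x by algebra
      finally have "u \<otimes> v = a \<otimes> i \<oplus> x \<otimes> (b \<otimes> i \<oplus> t \<otimes> u)" .
      moreover have "b \<otimes> i \<oplus> t \<otimes> u \<in> J \<up> Suc n"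
        using ideal_closed(3)[OF Jn bi ideal_closed(5)[OF Jn u t]] .
      ultimately show "u \<otimes> v \<in> D (Suc n)" unfolding D_def using ai by blast
    qed
  qed
  then show thesis using that c unfolding D_def J_def by blast
qed

lemma (in cring) prod_adjoin_pow_decomp:
  assumes Q: "ideal Q R" and I: "ideal I R" and x: "x \<in> carrier R"
    and c: "c \<in> Q \<cdot> (adjoin R I x \<up> Suc n)"
  obtains a b where "a \<in> Q \<cdot> I \<up> Suc n" "b \<in> Q \<cdot> (adjoin R I x \<up> n)" "c = a \<oplus> x \<otimes> b"
proof -
  define J where "J = adjoin R I x"
  have J: "ideal J R" using adjoin(1)[OF I x] unfolding J_def .
  note Jn = ideal_ideal_pow[OF J] and In = ideal_ideal_pow[OF I]
  define D where "D = {a \<oplus> x \<otimes> b | a b. a \<in> Q \<cdot> I \<up> Suc n \<and> b \<in> Q \<cdot> J \<up> n}"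
  have D: "ideal D R"
    unfolding D_def by (rule ideal_add_multiples[OF ideal_prod_is_ideal[OF Q In] ideal_prod_is_ideal[OF Q Jn] x])
  have "Q \<cdot> J \<up> Suc n \<subseteq> D"
  proof (rule ideal_prod_subset_ideal[OF D])
    fix q u assume q: "q \<in> Q" and u: "u \<in> J \<up> Suc n"
    obtain a b where a: "a \<in> I \<up> Suc n" and b: "b \<in> J \<up> n" and u': "u = a \<oplus> x \<otimes> b"
      using adjoin_pow_decomp[OF I x u[unfolded J_def]] unfolding J_def by metis
    have "q \<otimes> u = q \<otimes> a \<oplus> x \<otimes> (q \<otimes> b)"
      unfolding u' using ideal_closed(2)[OF Q q] ideal_closed(2)[OF In a] ideal_closed(2)[OF Jn b] x
      by algebra
    then show "q \<otimes> u \<in> D"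
      unfolding D_def using ideal_prod.prod[OF q a, of R] ideal_prod.prod[OF q b, of R] by blast
  qed
  then show thesis using that c unfolding D_def J_def by blast
qed

section \<open>Prime fibres of the associated graded ring\<close>

text \<open>For every prime \<open>Q\<close> containing \<open>I\<close>, the graded ring \<open>\<Oplus>\<^sub>n I\<^sup>n / Q I\<^sup>n\<close>, that is \<open>gr\<^sub>I(R) \<otimes> R/Q\<close>, is
required to be a domain; it suffices to test homogeneous elements. Quantifying over all
\<open>Q\<close>, and not only over \<open>Q = I\<close>, is what makes the property pass from \<open>I\<close> to \<open>I + (x)\<close>.\<close>

definition graded_prime :: "('a, 'b) ring_scheme \<Rightarrow> 'a set \<Rightarrow> bool"
  where "graded_prime R I \<longleftrightarrow> (\<forall>Q k l. \<forall>a \<in> ideal_pow R I k. \<forall>b \<in> ideal_pow R I l.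
    primeideal Q R \<longrightarrow> I \<subseteq> Q \<longrightarrow> a \<otimes>\<^bsub>R\<^esub> b \<in> ideal_prod R Q (ideal_pow R I (k + l)) \<longrightarrow>
    a \<in> ideal_prod R Q (ideal_pow R I k) \<or> b \<in> ideal_prod R Q (ideal_pow R I l))"

lemma graded_primeD:
  assumes "graded_prime R I" "primeideal Q R" "I \<subseteq> Q" "a \<in> ideal_pow R I k" "b \<in> ideal_pow R I l"
    and "a \<otimes>\<^bsub>R\<^esub> b \<in> ideal_prod R Q (ideal_pow R I (k + l))"
  shows "a \<in> ideal_prod R Q (ideal_pow R I k) \<or> b \<in> ideal_prod R Q (ideal_pow R I l)"
  using assms unfolding graded_prime_def by blast

lemma (in cring) graded_prime_zero: "graded_prime R {\<zero>}"
  unfolding graded_prime_def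
proof (intro allI ballI impI)
  fix Q k l a b
  assume a: "a \<in> {\<zero>} \<up> k" and b: "b \<in> {\<zero>} \<up> l" and Q: "primeideal Q R"
    and ab: "a \<otimes> b \<in> Q \<cdot> {\<zero>} \<up> (k + l)"
  have Q': "ideal Q R" using primeideal.axioms(1)[OF Q] .
  have zero: "\<zero> \<in> Q \<cdot> {\<zero>} \<up> n" for n
    using ideal_closed(1)[OF ideal_prod_is_ideal[OF Q' ideal_ideal_pow[OF zeroideal]]] .
  have pos: "{\<zero>} \<up> Suc n = {\<zero>}" for n
    by (simp add: ideal_pow_Suc ideal_prod_zero ideal_ideal_pow zeroideal)
  show "a \<in> Q \<cdot> {\<zero>} \<up> k \<or> b \<in> Q \<cdot> {\<zero>} \<up> l"
  proof (cases "k = 0 \<and> l = 0")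
    case True
    then have "a \<otimes> b \<in> Q" "a \<in> carrier R" "b \<in> carrier R"
      using ab a b by (simp_all add: ideal_pow_0 ideal_prod_one Q')
    then have "a \<in> Q \<or> b \<in> Q" using primeideal.I_prime[OF Q] by blast
    then show ?thesis using True by (simp add: ideal_pow_0 ideal_prod_one Q')
  next
    case False
    then have "a = \<zero> \<or> b = \<zero>" using a b pos by (metis not0_implies_Suc singletonD)
    then show ?thesis using zero by blast
  qed
qed

text \<open>Taking \<open>Q = I\<close> and giving \<open>x\<close> degree zero shows that \<open>x\<close> is a nonzerodivisor on each
\<open>I\<^sup>n / I\<^bsup>n+1\<^esup>\<close>, and therefore on each \<open>R / I\<^sup>n\<close>.\<close>

lemma (in cring) graded_prime_nonzerodivisor:
  assumes gr: "graded_prime R I" and I: "primeideal I R" and x: "x \<in> carrier R - I"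
    and a: "a \<in> carrier R" and xa: "x \<otimes> a \<in> I \<up> n"
  shows "a \<in> I \<up> n"
  using xa
proof (induction n)
  case 0
  then show ?case using a by (simp add: ideal_pow_0)
next
  case (Suc n)
  have I': "ideal I R" using primeideal.axioms(1)[OF I] .
  have "a \<in> I \<up> n" using Suc ideal_pow_Suc_subset[OF I'] by blast
  moreover have "x \<in> I \<up> 0" using x by (simp add: ideal_pow_0)
  ultimately have "x \<in> I \<cdot> I \<up> 0 \<or> a \<in> I \<cdot> I \<up> n"
    using graded_primeD[OF gr I, of x 0 a n] Suc.prems ideal_pow_Suc'[OF I'] by simp
  moreover have "I \<cdot> I \<up> 0 = I" using I' by (simp add: ideal_pow_0 ideal_prod_one)
  ultimately show ?case using x ideal_pow_Suc'[OF I'] by simp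
qed

text \<open>Morally \<open>gr\<^sub>J(R) \<otimes> R/Q\<close> is a polynomial ring in the class of \<open>x\<close> over \<open>gr\<^sub>I(R) \<otimes> R/Q\<close>, where
\<open>J = I + (x)\<close>. The proof is an induction on the total degree. Write \<open>a = c + x a'\<close> and
\<open>b = d + x b'\<close> with \<open>c, d\<close> in powers of \<open>I\<close>. Modulo \<open>x\<close> the hypothesis on \<open>a b\<close> says that \<open>c d\<close> is
zero in the graded ring of \<open>I\<close>, so \<open>c\<close> or \<open>d\<close> is. If it is \<open>c\<close>, then \<open>x a' b\<close> is zero in the graded ring of
\<open>J\<close>, where \<open>x\<close> can be cancelled, and the induction hypothesis applies to \<open>a' b\<close>.\<close>

theorem (in cring) graded_prime_adjoin:
  assumes gr: "graded_prime R I" and I: "primeideal I R" and x: "x \<in> carrier R - I"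
  shows "graded_prime R (adjoin R I x)"
proof -
  define J where "J = adjoin R I x"
  have I': "ideal I R" using primeideal.axioms(1)[OF I] .
  have xc: "x \<in> carrier R" using x by simp
  have J: "ideal J R" "I \<subseteq> J" "x \<in> J" using adjoin[OF I' xc] unfolding J_def by auto
  note Jn = ideal_ideal_pow[OF J(1)] and In = ideal_ideal_pow[OF I']
  have main: "a \<in> Q \<cdot> J \<up> r \<or> b \<in> Q \<cdot> J \<up> s"
    if Q: "primeideal Q R" and JQ: "J \<subseteq> Q" and a: "a \<in> J \<up> r" and b: "b \<in> J \<up> s"
      and ab: "a \<otimes> b \<in> Q \<cdot> J \<up> (r + s)" for Q a b r s
    using a b ab
  proof (induction "r + s" arbitrary: a b r s)
    case 0
    have "Q \<cdot> J \<up> 0 = Q" using primeideal.axioms(1)[OF Q] by (simp add: ideal_pow_0 ideal_prod_one)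
    then show ?case using 0 primeideal.I_prime[OF Q, of a b] by (simp add: ideal_pow_0)
  next
    case (Suc N)
    have Q': "ideal Q R" using primeideal.axioms(1)[OF Q] .
    note QJn = ideal_prod_is_ideal[OF Q' Jn] and QIn = ideal_prod_is_ideal[OF Q' In]
    have QI_QJ: "Q \<cdot> I \<up> n \<subseteq> Q \<cdot> J \<up> n" for n
      using ideal_prod_mono[OF order_refl ideal_pow_mono[OF J(2)]] .
    have xQJ: "x \<otimes> c \<in> Q \<cdot> J \<up> Suc n" if c: "c \<in> Q \<cdot> J \<up> n" for c n
      using ideal_prod_pow_mult[OF Q' J(1) c, of x 1] J(3) ideal_pow_1[OF J(1)]
        m_comm[OF xc ideal_closed(2)[OF QJn c]] by simp
    have Q_mult: "q \<otimes> c \<in> Q \<cdot> I \<up> n" if "q \<in> Q" "c \<in> I \<up> n" for q c n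
      using that by (rule ideal_prod.prod)
    \<comment> \<open>Multiplication by \<open>x\<close> is injective on the graded ring of \<open>J\<close> modulo \<open>Q\<close>.\<close>
    have cancel: "e \<in> Q \<cdot> J \<up> N" if e: "e \<in> J \<up> N" and xe: "x \<otimes> e \<in> Q \<cdot> J \<up> Suc N" for e
    proof -
      obtain p e' where p: "p \<in> Q \<cdot> I \<up> Suc N" and e': "e' \<in> Q \<cdot> J \<up> N" and eq: "x \<otimes> e = p \<oplus> x \<otimes> e'"
        using prod_adjoin_pow_decomp[OF Q' I' xc xe[unfolded J_def]] unfolding J_def by metis
      have ec: "e \<in> carrier R" and e'c: "e' \<in> carrier R" and pc: "p \<in> carrier R"
        using ideal_closed(2)[OF Jn e] ideal_closed(2)[OF QJn e'] ideal_closed(2)[OF QIn p] by auto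
      have "x \<otimes> (e \<ominus> e') = x \<otimes> e \<ominus> x \<otimes> e'" "(p \<oplus> x \<otimes> e') \<ominus> x \<otimes> e' = p"
        using xc ec e'c pc by algebra+
      then have "x \<otimes> (e \<ominus> e') = p" using eq by simp
      moreover have "p \<in> I \<up> Suc N" using p ideal_prod_inter[OF Q' In] by blast
      ultimately have "e \<ominus> e' \<in> I \<up> Suc N"
        using graded_prime_nonzerodivisor[OF gr I x, of "e \<ominus> e'"] ec e'c by simp
      then have "e \<ominus> e' \<in> Q \<cdot> J \<up> N"
        using ideal_pow_Suc'[OF I', of N] ideal_prod_mono[OF order_trans[OF J(2) JQ] order_refl, of "I \<up> N"]
          QI_QJ[of N] by blast
      then have "e \<ominus> e' \<oplus> e' \<in> Q \<cdot> J \<up> N" using ideal_closed(3)[OF QJn _ e'] by blast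
      moreover have "e \<ominus> e' \<oplus> e' = e" using ec e'c by algebra
      ultimately show ?thesis by simp
    qed
    \<comment> \<open>In degree zero there is nothing to split off; \<open>d = \<zero>\<close> then makes the truncated \<open>n - 1\<close> harmless.\<close>
    have split: "\<exists>c\<in>I \<up> n. \<exists>d\<in>J \<up> (n - 1). d' = c \<oplus> x \<otimes> d \<and> (n = 0 \<longrightarrow> d = \<zero>)"
      if d': "d' \<in> J \<up> n" for d' n
    proof (cases n)
      case 0
      have "d' \<in> carrier R" using ideal_closed(2)[OF Jn d'] .
      then have "d' = d' \<oplus> x \<otimes> \<zero>" using xc by simp
      then show ?thesis using 0 \<open>d' \<in> carrier R\<close> by (auto simp: ideal_pow_0)
    next
      case (Suc m)
      then show ?thesis using adjoin_pow_decomp[OF I' xc, of d' m] d' unfolding J_def by (metis diff_Suc_1 nat.distinct(1))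
    qed
    obtain c a' where c: "c \<in> I \<up> r" and a': "a' \<in> J \<up> (r - 1)" and aeq: "a = c \<oplus> x \<otimes> a'"
      and a'0: "r = 0 \<longrightarrow> a' = \<zero>" using split[OF Suc.prems(1)] by blast
    obtain d b' where d: "d \<in> I \<up> s" and b': "b' \<in> J \<up> (s - 1)" and beq: "b = d \<oplus> x \<otimes> b'"
      and b'0: "s = 0 \<longrightarrow> b' = \<zero>" using split[OF Suc.prems(2)] by blast
    have carr: "c \<in> carrier R" "a' \<in> carrier R" "d \<in> carrier R" "b' \<in> carrier R"
      using ideal_closed(2)[OF In c] ideal_closed(2)[OF Jn a'] ideal_closed(2)[OF In d] ideal_closed(2)[OF Jn b']
      by auto
    have rs: "r + s = Suc N" using Suc.hyps(2) by simp
    have "c \<otimes> d \<in> Q \<cdot> I \<up> (r + s)"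
    proof -
      obtain p e where p: "p \<in> Q \<cdot> I \<up> Suc N" and e: "e \<in> Q \<cdot> J \<up> N" and eq: "a \<otimes> b = p \<oplus> x \<otimes> e"
        using prod_adjoin_pow_decomp[OF Q' I' xc, of "a \<otimes> b" N] Suc.prems(3) rs unfolding J_def by metis
      have ec: "e \<in> carrier R" and pc: "p \<in> carrier R"
        using ideal_closed(2)[OF QJn e] ideal_closed(2)[OF QIn p] by auto
      \<comment> \<open>\<open>w\<close> is the coefficient of \<open>x\<close> in \<open>c d - p\<close>; as \<open>x w\<close> lies in a power of \<open>I\<close>, so does \<open>w\<close>.\<close>
      define w where "w = e \<ominus> (c \<otimes> b' \<oplus> d \<otimes> a' \<oplus> x \<otimes> a' \<otimes> b')"
      have wc: "w \<in> carrier R" unfolding w_def using ec carr xc by simp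
      have "c \<otimes> d = a \<otimes> b \<ominus> x \<otimes> (c \<otimes> b' \<oplus> d \<otimes> a' \<oplus> x \<otimes> a' \<otimes> b')"
        unfolding aeq beq using carr xc by algebra
      then have "c \<otimes> d = (p \<oplus> x \<otimes> e) \<ominus> x \<otimes> (c \<otimes> b' \<oplus> d \<otimes> a' \<oplus> x \<otimes> a' \<otimes> b')" using eq by simp
      also have "\<dots> = p \<oplus> x \<otimes> w" unfolding w_def using carr xc pc ec by algebra
      finally have cd: "c \<otimes> d = p \<oplus> x \<otimes> w" .
      have "c \<otimes> d \<in> I \<up> Suc N" using ideal_pow_mult[OF I' c d] rs by simp
      moreover have "p \<in> I \<up> Suc N" using p ideal_prod_inter[OF Q' In] by blast
      ultimately have "c \<otimes> d \<ominus> p \<in> I \<up> Suc N" using ideal_closed(4)[OF In] by blast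
      moreover have "(p \<oplus> x \<otimes> w) \<ominus> p = x \<otimes> w" using pc xc wc by algebra
      ultimately have "x \<otimes> w \<in> I \<up> Suc N" using cd by simp
      then have "w \<in> I \<up> Suc N" using graded_prime_nonzerodivisor[OF gr I x wc] by blast
      then have "x \<otimes> w \<in> Q \<cdot> I \<up> Suc N" using Q_mult J(3) JQ by blast
      then show ?thesis unfolding rs cd using ideal_closed(3)[OF QIn p] by blast
    qed
    then have "c \<in> Q \<cdot> I \<up> r \<or> d \<in> Q \<cdot> I \<up> s"
      using graded_primeD[OF gr Q _ c d] J(2) JQ by blast
    then show ?case
    proof
      assume cQ: "c \<in> Q \<cdot> I \<up> r"
      then have cQ': "c \<in> Q \<cdot> J \<up> r" using QI_QJ by blast
      show ?thesis
      proof (cases r)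
        case 0
        then show ?thesis using cQ' a'0 aeq xc carr by simp
      next
        case (Suc r')
        have N: "N = r' + s" using rs Suc by simp
        have "c \<otimes> b \<in> Q \<cdot> J \<up> (r + s)" using ideal_prod_pow_mult[OF Q' J(1) cQ' Suc.prems(2)] .
        then have "a \<otimes> b \<ominus> c \<otimes> b \<in> Q \<cdot> J \<up> Suc N" using ideal_closed(4)[OF QJn Suc.prems(3)] rs by simp
        moreover have "a \<otimes> b \<ominus> c \<otimes> b = x \<otimes> (a' \<otimes> b)"
          unfolding aeq using carr xc ideal_closed(2)[OF Jn Suc.prems(2)] by algebra
        ultimately have "x \<otimes> (a' \<otimes> b) \<in> Q \<cdot> J \<up> Suc N" by simp
        moreover have a'r: "a' \<in> J \<up> r'" using a' Suc by simp
        moreover have "a' \<otimes> b \<in> J \<up> N" unfolding N using ideal_pow_mult[OF J(1) a'r Suc.prems(2)] .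
        ultimately have "a' \<otimes> b \<in> Q \<cdot> J \<up> (r' + s)" using cancel N by blast
        then have "a' \<in> Q \<cdot> J \<up> r' \<or> b \<in> Q \<cdot> J \<up> s" using Suc.hyps(1)[OF N a'r Suc.prems(2)] by blast
        then show ?thesis
        proof
          assume "a' \<in> Q \<cdot> J \<up> r'"
          then have "x \<otimes> a' \<in> Q \<cdot> J \<up> r" using xQJ Suc by blast
          then show ?thesis using ideal_closed(3)[OF QJn cQ'] aeq by blast
        qed simp
      qed
    next
      assume dQ: "d \<in> Q \<cdot> I \<up> s"
      then have dQ': "d \<in> Q \<cdot> J \<up> s" using QI_QJ by blast
      show ?thesis
      proof (cases s)
        case 0
        then show ?thesis using dQ' b'0 beq xc carr by simp
      next
        case (Suc s')
        have N: "N = r + s'" using rs Suc by simp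
        have ac: "a \<in> carrier R" using ideal_closed(2)[OF Jn Suc.prems(1)] .
        have "d \<otimes> a \<in> Q \<cdot> J \<up> (s + r)" using ideal_prod_pow_mult[OF Q' J(1) dQ' Suc.prems(1)] .
        then have "d \<otimes> a \<in> Q \<cdot> J \<up> (r + s)" by (simp add: add.commute)
        then have "a \<otimes> b \<ominus> d \<otimes> a \<in> Q \<cdot> J \<up> Suc N" using ideal_closed(4)[OF QJn Suc.prems(3)] rs by simp
        moreover have "a \<otimes> b \<ominus> d \<otimes> a = x \<otimes> (a \<otimes> b')"
          unfolding beq using carr xc ac by algebra
        ultimately have "x \<otimes> (a \<otimes> b') \<in> Q \<cdot> J \<up> Suc N" by simp
        moreover have b's: "b' \<in> J \<up> s'" using b' Suc by simp
        moreover have "a \<otimes> b' \<in> J \<up> N" unfolding N using ideal_pow_mult[OF J(1) Suc.prems(1) b's] .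
        ultimately have "a \<otimes> b' \<in> Q \<cdot> J \<up> (r + s')" using cancel N by blast
        then have "a \<in> Q \<cdot> J \<up> r \<or> b' \<in> Q \<cdot> J \<up> s'" using Suc.hyps(1)[OF N Suc.prems(1) b's] by blast
        then show ?thesis
        proof
          assume "b' \<in> Q \<cdot> J \<up> s'"
          then have "x \<otimes> b' \<in> Q \<cdot> J \<up> s" using xQJ Suc by blast
          then show ?thesis using ideal_closed(3)[OF QJn dQ'] beq by blast
        qed simp
      qed
    qed
  qed
  show ?thesis
    unfolding graded_prime_def J_def[symmetric] using main by blast
qed

section \<open>The order function of a regular local ring\<close>

lemma prime_chain_mono:
  assumes "prime_chain R n P" "i \<le> j" "j \<le> n"
  shows "P i \<subseteq> P j"
  using assms(2,3)
proof (induction j rule: dec_induct)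
  case (step j)
  then have "P j \<subset> P (Suc j)" using assms(1) unfolding prime_chain_def by simp
  then show ?case using step by auto
qed simp

text \<open>If \<open>\<mm>\<close> is generated by \<open>e\<close> elements over \<open>I\<close> and there is a chain of \<open>e + 1\<close> primes between \<open>I\<close> and \<open>\<mm>\<close>,
then \<open>R/I\<close> is a regular local ring, and hence a domain of which the bottom of the chain is the zero ideal.
Some generator \<open>z\<close> lies outside \<open>P 0\<close>. A shorter chain \<open>Q\<close> passes through \<open>z\<close>, and by induction its
bottom \<open>Q 0\<close> equals \<open>I + (z)\<close>. As \<open>P 0\<close> is contained in it, \<open>P 0 \<subseteq> I + z P 0\<close>, so Nakayama yields
\<open>P 0 = I\<close>. The generators thus form a sequence of elements each of which lies outside the prime that the
earlier ones generate together with \<open>I\<close>, and along this sequence the property \<^const>\<open>graded_prime\<close> is inherited step by step.\<close>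

lemma (in noetherian_cring) graded_prime_of_chain:
  assumes m: "primeideal \<mm> R" and units: "carrier R - \<mm> \<subseteq> Units R"
    and "ideal I R" "finite S" "card S = e" "S \<subseteq> carrier R" "\<mm> = Idl (I \<union> S)"
    and "prime_chain R e P" "P e = \<mm>" "I \<subseteq> P 0"
  shows "I = P 0 \<and> (graded_prime R I \<longrightarrow> graded_prime R \<mm>)"
  using assms(3-)
proof (induction e arbitrary: I S P)
  case 0
  then have "S = {}" by simp
  then have "\<mm> = I" using 0 genideal_minimal[OF 0(1), of I] genideal_self[of I] ideal_closed(2)[OF 0(1)] by auto
  then show ?case using 0 by simp
next
  case (Suc e)
  note I = Suc.prems(1) and fin = Suc.prems(2) and card = Suc.prems(3) and S = Suc.prems(4)
    and gen = Suc.prems(5) and chain = Suc.prems(6) and top = Suc.prems(7) and IP = Suc.prems(8)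
  have ISc: "I \<union> S \<subseteq> carrier R" using S ideal_closed(2)[OF I] by blast
  have P0: "primeideal (P 0) R" and "P 0 \<subset> P 1" using chain unfolding prime_chain_def by auto
  then have P0m: "P 0 \<subset> \<mm>" using prime_chain_mono[OF chain, of 1 "Suc e"] top by auto
  note P0' = primeideal.axioms(1)[OF P0]
  have "\<not> S \<subseteq> P 0"
    using genideal_minimal[OF P0', of "I \<union> S"] IP gen P0m by blast
  then obtain z where z: "z \<in> S" "z \<notin> P 0" by blast
  have zc: "z \<in> carrier R" and zm: "z \<in> \<mm>" using z S genideal_self[OF ISc] gen by auto
  obtain Q where Q: "prime_chain R e Q" "Q e = \<mm>" "P 0 \<subset> Q 0" "z \<in> Q 0"
    using prime_chain_through[OF chain, of z] zm top by auto
  define J where "J = adjoin R I z"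
  have J: "ideal J R" "I \<subseteq> J" "z \<in> J" using adjoin[OF I zc] unfolding J_def by auto
  have Q0: "ideal (Q 0) R" using Q(1) primeideal.axioms(1) unfolding prime_chain_def by blast
  have JQ: "J \<subseteq> Q 0" unfolding J_def using adjoin_least[OF Q0] IP Q(3,4) by blast
  have gen': "\<mm> = Idl (J \<union> (S - {z}))"
  proof
    have JSc: "J \<union> (S - {z}) \<subseteq> carrier R" using S ideal_closed(2)[OF J(1)] by blast
    show "\<mm> \<subseteq> Idl (J \<union> (S - {z}))"
      unfolding gen using genideal_self[OF JSc] J(2,3)
      by (intro genideal_minimal[OF genideal_ideal[OF JSc]]) blast
    have "I \<union> S \<subseteq> \<mm>" unfolding gen by (rule genideal_self[OF ISc])
    moreover have "J \<subseteq> \<mm>"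
      unfolding J_def using adjoin_least[OF primeideal.axioms(1)[OF m]] calculation zm by blast
    ultimately show "Idl (J \<union> (S - {z})) \<subseteq> \<mm>"
      by (intro genideal_minimal[OF primeideal.axioms(1)[OF m]]) blast
  qed
  have IH: "J = Q 0 \<and> (graded_prime R J \<longrightarrow> graded_prime R \<mm>)"
    using Suc.IH[OF J(1) _ _ _ gen' Q(1,2) JQ] fin card z(1) S by (simp add: subset_iff)
  have "saturated R \<mm> I"
    unfolding saturated_def
  proof (intro ballI impI)
    fix s a assume s: "s \<in> carrier R - \<mm>" and a: "a \<in> carrier R" and sa: "s \<otimes> a \<in> I"
    have u: "s \<in> Units R" using s units by blast
    have "inv s \<otimes> (s \<otimes> a) \<in> I" using ideal_closed(5)[OF I sa] u by simp
    moreover have "inv s \<otimes> (s \<otimes> a) = a"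
      using u a s by (simp add: m_assoc[symmetric])
    ultimately show "a \<in> I" by simp
  qed
  then have "P 0 \<subseteq> I"
  proof (rule nakayama_saturated[OF m zm P0' I])
    fix a assume a: "a \<in> P 0"
    then have "a \<in> J" using Q(3) IH by blast
    then obtain i t where i: "i \<in> I" and t: "t \<in> carrier R" and eq: "a = i \<oplus> t \<otimes> z"
      unfolding J_def adjoin_iff by blast
    have ic: "i \<in> carrier R" and ac: "a \<in> carrier R"
      using ideal_closed(2)[OF I i] ideal_closed(2)[OF P0' a] by auto
    have "a \<ominus> i \<in> P 0" using ideal_closed(4)[OF P0' a] i IP by blast
    moreover have "(i \<oplus> t \<otimes> z) \<ominus> i = t \<otimes> z" using ic t zc by algebra
    ultimately have "t \<otimes> z \<in> P 0" using eq by simp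
    then have "t \<in> P 0" using primeideal.I_prime[OF P0 t zc] z(2) by blast
    moreover have "\<one> \<otimes> a = i \<oplus> z \<otimes> t" using ac eq m_comm[OF zc t] by simp
    ultimately show "\<exists>s\<in>carrier R - \<mm>. \<exists>n\<in>I. \<exists>b\<in>P 0. s \<otimes> a = n \<oplus> z \<otimes> b"
      using one_notin_prime[OF m] i by blast
  qed
  then have eq: "I = P 0" using IP by blast
  have "graded_prime R J" if "graded_prime R I"
    unfolding J_def using graded_prime_adjoin[OF that, of z] P0 eq z(2) zc by simp
  then show ?case using eq IH by blast
qed

sublocale regular_local_ring \<subseteq> noetherian_cring R ..

context regular_local_ring
begin

lemma maximal_ideal_prime: "primeideal \<mm> R"
  using maximalideal_prime[OF is_maximalideal] .

lemma unit_outside_maximal_ideal: "carrier R - \<mm> \<subseteq> Units R"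
proof
  fix a assume a: "a \<in> carrier R - \<mm>"
  show "a \<in> Units R"
  proof (rule ccontr)
    assume nu: "a \<notin> Units R"
    have ac: "a \<in> carrier R" using a by simp
    define \<Phi> where "\<Phi> J \<longleftrightarrow> a \<in> J \<and> \<one> \<notin> J" for J
    have "\<one> \<notin> PIdl a"
    proof
      assume "\<one> \<in> PIdl a"
      then obtain b where b: "b \<in> carrier R" "\<one> = b \<otimes> a" unfolding cgenideal_def by blast
      then have "a \<in> Units R" using ac m_comm[OF ac b(1)] unfolding Units_def by auto
      then show False using nu by simp
    qed
    then have "\<Phi> (PIdl a)" unfolding \<Phi>_def using cgenideal_self[OF ac] by simp
    then obtain M where M: "ideal M R" "\<Phi> M" and max: "\<And>J. ideal J R \<Longrightarrow> \<Phi> J \<Longrightarrow> M \<subseteq> J \<Longrightarrow> J = M"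
      using exists_maximal_ideal_with[OF cgenideal_ideal[OF ac], of \<Phi>] by metis
    have "maximalideal M R"
    proof (rule maximalidealI[OF M(1)])
      show "carrier R \<noteq> M" using M(2) one_closed unfolding \<Phi>_def by blast
      fix J assume J: "ideal J R" "M \<subseteq> J" "J \<subseteq> carrier R"
      show "J = M \<or> J = carrier R"
      proof (cases "\<one> \<in> J")
        case True
        then show ?thesis using ideal.one_imp_carrier[OF J(1)] by simp
      next
        case False
        then have "\<Phi> J" using J(2) M(2) unfolding \<Phi>_def by blast
        then show ?thesis using max[OF J(1)] J(2) by blast
      qed
    qed
    then have "M = \<mm>" by (rule unique_maximal)
    then show False using a M(2) unfolding \<Phi>_def by blast
  qed
qed

lemma prime_subset_maximal:
  assumes "primeideal P R"
  shows "P \<subseteq> \<mm>"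
proof
  note P = primeideal.axioms(1)[OF assms]
  fix a assume a: "a \<in> P"
  show "a \<in> \<mm>"
  proof (rule ccontr)
    assume "a \<notin> \<mm>"
    then have u: "a \<in> Units R" using unit_outside_maximal_ideal ideal_closed(2)[OF P a] by blast
    have "inv a \<otimes> a \<in> P" using ideal_closed(5)[OF P a Units_inv_closed[OF u]] .
    then show False using u one_notin_prime[OF assms] by simp
  qed
qed

text \<open>Regularity supplies \<open>d\<close> generators of \<open>\<mm>\<close> and a chain of primes of length \<open>d\<close>; by maximality of \<open>d\<close> the
chain ends in \<open>\<mm>\<close>. So \<open>graded_prime_of_chain\<close> applies with \<open>I\<close> the zero ideal.\<close>

theorem graded_prime_maximal_ideal: "graded_prime R \<mm>"
proof -
  define A where "A = {enat n | n. \<exists>P. prime_chain R n P}"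
  have "\<exists>n. \<exists>S\<subseteq>carrier R. finite S \<and> card S = n \<and> \<mm> = Idl S"
    using finetely_gen[OF is_ideal] by auto
  then have "\<exists>S\<subseteq>carrier R. finite S \<and> card S = min_gens R \<mm> \<and> \<mm> = Idl S"
    unfolding min_gens_def by (rule LeastI_ex)
  then obtain S where S: "S \<subseteq> carrier R" "finite S" "card S = min_gens R \<mm>" "\<mm> = Idl S" by blast
  define d where "d = min_gens R \<mm>"
  have SupA: "Sup A = enat d" using regular unfolding A_def d_def krull_dim_def by simp
  have "prime_chain R 0 (\<lambda>_. \<mm>)" using maximal_ideal_prime unfolding prime_chain_def by simp
  then have "A \<noteq> {}" unfolding A_def by blast
  then have "finite A" "Max A = enat d"
    using SupA unfolding Sup_enat_def by (auto split: if_splits)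
  then have "enat d \<in> A" using Max_in \<open>A \<noteq> {}\<close> by metis
  then obtain P where P: "prime_chain R d P" unfolding A_def by blast
  have "P d = \<mm>"
  proof (rule ccontr)
    assume "P d \<noteq> \<mm>"
    moreover have "P d \<subseteq> \<mm>" using P prime_subset_maximal unfolding prime_chain_def by simp
    ultimately have "prime_chain R (Suc d) (P(Suc d := \<mm>))"
      using P maximal_ideal_prime unfolding prime_chain_def by (auto simp: less_Suc_eq)
    then have "enat (Suc d) \<in> A" unfolding A_def by blast
    then have "enat (Suc d) \<le> enat d" using Sup_upper[of _ A] SupA by metis
    then show False by simp
  qed
  moreover have P0: "{\<zero>} \<subseteq> P 0"
    using P ideal_closed(1)[OF primeideal.axioms(1)] unfolding prime_chain_def by blast
  moreover have "\<mm> = Idl ({\<zero>} \<union> S)"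
  proof
    have c: "{\<zero>} \<union> S \<subseteq> carrier R" using S(1) by simp
    show "\<mm> \<subseteq> Idl ({\<zero>} \<union> S)" unfolding S(4) using subset_Idl_subset[OF c, of S] by blast
    show "Idl ({\<zero>} \<union> S) \<subseteq> \<mm>"
      using genideal_self[OF S(1)] S(4) ideal_closed(1)[OF is_ideal] by (intro genideal_minimal[OF is_ideal]) blast
  qed
  ultimately show ?thesis
    using graded_prime_of_chain[OF maximal_ideal_prime unit_outside_maximal_ideal zeroideal S(2) S(3)[folded d_def]
        S(1) _ P] graded_prime_zero by blast
qed

text \<open>The order is additive on products because the associated graded ring of \<open>\<mm>\<close> is a domain.\<close>

lemma order_mult:
  assumes "a \<in> \<mm> \<up> k - \<mm> \<up> Suc k" "b \<in> \<mm> \<up> l - \<mm> \<up> Suc l"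
  shows "a \<otimes> b \<in> \<mm> \<up> (k + l) - \<mm> \<up> Suc (k + l)"
proof
  show "a \<otimes> b \<in> \<mm> \<up> (k + l)" using ideal_pow_mult[OF is_ideal, of a k b l] assms by blast
  show "a \<otimes> b \<notin> \<mm> \<up> Suc (k + l)"
    using graded_primeD[OF graded_prime_maximal_ideal maximal_ideal_prime order_refl, of a k b l] assms
    by (auto simp: ideal_pow_Suc'[OF is_ideal])
qed

lemma order_power:
  assumes "a \<in> \<mm> \<up> k - \<mm> \<up> Suc k"
  shows "a [^] n \<in> \<mm> \<up> (n * k) - \<mm> \<up> Suc (n * k)"
proof (induction n)
  case 0
  then show ?case using one_notin_prime[OF maximal_ideal_prime] by (simp add: ideal_pow_0 ideal_pow_1[OF is_ideal])
next
  case (Suc n)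
  then show ?case using order_mult[OF Suc assms] by (simp add: add.commute)
qed

lemma ideal_pow_antimono:
  assumes "k \<le> l"
  shows "\<mm> \<up> l \<subseteq> \<mm> \<up> k"
  using assms by (rule lift_Suc_antimono_le[of "\<lambda>n. \<mm> \<up> n", OF ideal_pow_Suc_subset[OF is_ideal]])

lemma ord_at_eq:
  assumes "a \<in> \<mm> \<up> k - \<mm> \<up> Suc k"
  shows "ord_at R \<mm> a = k"
  unfolding ord_at_def
proof (rule the_equality)
  show "a \<in> \<mm> \<up> k - \<mm> \<up> Suc k" by (rule assms)
next
  fix r assume r: "a \<in> \<mm> \<up> r - \<mm> \<up> Suc r"
  have "\<not> Suc r \<le> k" "\<not> Suc k \<le> r"
    using ideal_pow_antimono[of "Suc r" k] ideal_pow_antimono[of "Suc k" r] assms r by blast+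
  then show "r = k" by simp
qed

lemma ord_at_mem:
  assumes "a \<in> carrier R" "a \<notin> \<mm> \<up> N"
  shows "a \<in> \<mm> \<up> ord_at R \<mm> a - \<mm> \<up> Suc (ord_at R \<mm> a)"
proof -
  define n where "n = (LEAST n. a \<notin> \<mm> \<up> n)"
  have n: "a \<notin> \<mm> \<up> n" unfolding n_def using assms(2) by (rule LeastI)
  then obtain k where k: "n = Suc k" using assms(1) by (cases n) (simp_all add: ideal_pow_0)
  have "a \<in> \<mm> \<up> k" using not_less_Least[of k "\<lambda>n. a \<notin> \<mm> \<up> n"] k unfolding n_def by simp
  then have "a \<in> \<mm> \<up> k - \<mm> \<up> Suc k" using n k by simp
  then show ?thesis using ord_at_eq by simp
qed

end

section \<open>Domination along the family\<close>

context quadratic_family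
begin

abbreviation ring_at :: "nat \<Rightarrow> ('a, 'b) ring_scheme"
  where "ring_at n \<equiv> restrict_ring K (R n)"

abbreviation order_at :: "nat \<Rightarrow> 'a \<Rightarrow> nat"
  where "order_at n \<equiv> ord_at (ring_at n) (\<mm> n)"

sublocale member: regular_local_ring "\<mm> n" "ring_at n" for n
  by (rule regular_local)

lemma ring_at_mono: "i \<le> j \<Longrightarrow> R i \<subseteq> R j"
  by (rule lift_Suc_mono_le[of R, OF increasing])

lemma ring_at_carrier: "a \<in> R n \<Longrightarrow> a \<in> carrier K"
  using subringE(1)[OF subring] by blast

lemma maximal_ideal_subset: "\<mm> n \<subseteq> R n"
  using ideal.Icarr[OF member.is_ideal] by auto

lemma inv_closed: "a \<in> carrier K - {\<zero>} \<Longrightarrow> inv a \<in> carrier K - {\<zero>}"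
  using field_Units Units_inv_Units by blast

lemma inv_mult: "a \<in> carrier K - {\<zero>} \<Longrightarrow> inv a \<otimes> a = \<one>" "a \<in> carrier K - {\<zero>} \<Longrightarrow> a \<otimes> inv a = \<one>"
  using field_Units by auto

lemma not_inverse_in_ring:
  assumes "y \<in> \<mm> n" "y \<noteq> \<zero>"
  shows "inv y \<notin> R n"
proof
  assume "inv y \<in> R n"
  then have "inv y \<otimes> y \<in> \<mm> n"
    using member.ideal_closed(5)[OF member.is_ideal assms(1), of "inv y"] by simp
  moreover have "y \<in> carrier K - {\<zero>}" using assms maximal_ideal_subset ring_at_carrier by blast
  ultimately have "\<one> \<in> \<mm> n" using inv_mult by simp
  then show False using member.one_notin_prime[OF member.maximal_ideal_prime] by simp
qed

text \<open>Each \<open>R (n+1)\<close> dominates \<open>R n\<close>. If \<open>y \<in> \<mm> n\<close> had the inverse \<open>a/s\<close> in the localization at \<open>p\<close>, then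
\<open>s = a y\<close> would lie in \<open>p\<close>, as \<open>\<mm> n \<subseteq> p\<close>.\<close>

lemma maximal_ideal_step: "\<mm> n \<subseteq> \<mm> (Suc n)"
proof
  fix y assume y: "y \<in> \<mm> n"
  have yR: "y \<in> R n" and yc: "y \<in> carrier K"
    using y maximal_ideal_subset ring_at_carrier by blast+
  have "y \<in> R (Suc n)" using yR increasing by blast
  obtain x p where x: "x \<in> \<mm> n - ideal_pow (ring_at n) (\<mm> n) 2"
    and p: "primeideal p (restrict_ring K (blowup_chart K (R n) (\<mm> n) x))" and mp: "\<mm> n \<subseteq> p"
    and eq: "R (Suc n) = localization_in K (blowup_chart K (R n) (\<mm> n) x) p"
    using quadratic_transform[of n] unfolding local_quadratic_transform_def by blast
  define C where "C = blowup_chart K (R n) (\<mm> n) x"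
  have pid: "ideal p (restrict_ring K C)" using primeideal.axioms(1)[OF p] unfolding C_def .
  have "\<zero> \<in> ideal_pow (ring_at n) (\<mm> n) 2"
    using member.ideal_closed(1)[OF member.ideal_ideal_pow[OF member.is_ideal]] by simp
  then have "x \<noteq> \<zero>" using x by blast
  moreover have "x \<in> carrier K" using x maximal_ideal_subset ring_at_carrier by blast
  ultimately have xinv: "inv x \<in> carrier K" using inv_closed by blast
  have "R n \<union> {y \<otimes> inv x | y. y \<in> \<mm> n} \<subseteq> carrier K"
    using xinv maximal_ideal_subset[of n] ring_at_carrier[of _ n] by (auto simp: subset_iff)
  then have Cc: "C \<subseteq> carrier K"
    unfolding C_def blowup_chart_def by (rule generate_ring_incl)
  show "y \<in> \<mm> (Suc n)"
  proof (rule ccontr)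
    assume "y \<notin> \<mm> (Suc n)"
    then have "y \<in> Units (ring_at (Suc n))"
      using member.unit_outside_maximal_ideal[of "Suc n"] \<open>y \<in> R (Suc n)\<close> by auto
    then obtain b where b: "b \<in> R (Suc n)" "b \<otimes> y = \<one>" unfolding Units_def by auto
    obtain a s where a: "a \<in> C" and s: "s \<in> C - p" and bas: "b = a \<otimes> inv s"
      using b(1) unfolding eq localization_in_def C_def by blast
    have "\<zero> \<in> p" using additive_subgroup.zero_closed[OF ideal.axioms(1)[OF pid]] by simp
    then have sc: "s \<in> carrier K - {\<zero>}" using s Cc by blast
    have ac: "a \<in> carrier K" using a Cc by blast
    have sic: "inv s \<in> carrier K" using inv_closed[OF sc] by simp
    have "a \<otimes> y = (inv s \<otimes> s) \<otimes> (a \<otimes> y)" using inv_mult[OF sc] ac yc by simp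
    also have "\<dots> = (b \<otimes> y) \<otimes> s" unfolding bas using sic sc ac yc by (simp add: m_ac)
    also have "\<dots> = s" using b(2) sc by simp
    finally have "a \<otimes> y = s" .
    moreover have "a \<otimes> y \<in> p"
      using ideal.I_l_closed[OF pid, of y a] y mp a by auto
    ultimately show False using s by simp
  qed
qed

lemma maximal_ideal_mono: "i \<le> j \<Longrightarrow> \<mm> i \<subseteq> \<mm> j"
  by (rule lift_Suc_mono_le[of \<mm>, OF maximal_ideal_step])

end

section \<open>Orders and values\<close>

locale valued_quadratic_family = quadratic_family K R \<mm> + real_valuation K v
  for K (structure) and R :: "nat \<Rightarrow> 'a set" and \<mm> :: "nat \<Rightarrow> 'a set" and v :: "'a \<Rightarrow> real" +
  assumes valuation_ring_eq: "valuation_ring K v = (\<Union>n. R n)"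
begin

lemma val_one: "v \<one> = 0"
  using val_mult[of \<one> \<one>] by simp

lemma val_inv: "a \<in> carrier K - {\<zero>} \<Longrightarrow> v (inv a) = - v a"
  using val_mult[OF inv_closed, of a a] inv_mult(1)[of a] val_one by simp

lemma pow_nonzero: "a \<in> carrier K - {\<zero>} \<Longrightarrow> a [^] (n::nat) \<in> carrier K - {\<zero>}"
  by (induction n) (auto simp: integral_iff)

lemma val_pow: "a \<in> carrier K - {\<zero>} \<Longrightarrow> v (a [^] (n::nat)) = n * v a"
proof (induction n)
  case (Suc n)
  then show ?case using val_mult[OF pow_nonzero[of a n], of a] by (simp add: algebra_simps)
qed (simp add: val_one)

lemma val_nonneg: "a \<in> R n \<Longrightarrow> a \<noteq> \<zero> \<Longrightarrow> 0 \<le> v a"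
  using valuation_ring_eq unfolding valuation_ring_def by blast

text \<open>By domination \<open>y\<close> remains a nonunit in every later ring of the family, so it is a nonunit of the valuation ring.\<close>

lemma val_pos:
  assumes y: "y \<in> \<mm> n" "y \<noteq> \<zero>"
  shows "0 < v y"
proof (rule ccontr)
  assume "\<not> 0 < v y"
  have yR: "y \<in> R n" using y maximal_ideal_subset by blast
  then have yc: "y \<in> carrier K - {\<zero>}" using y ring_at_carrier by blast
  have "v (inv y) \<ge> 0" using \<open>\<not> 0 < v y\<close> val_inv[OF yc] by simp
  then have "inv y \<in> (\<Union>n. R n)"
    using inv_closed[OF yc] unfolding valuation_ring_eq[symmetric] valuation_ring_def by simp
  then obtain k where k: "inv y \<in> R k" by blast
  define N where "N = max n k"
  have "y \<in> \<mm> N" using y(1) maximal_ideal_mono[of n N] unfolding N_def by auto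
  moreover have "inv y \<in> R N" using k ring_at_mono[of k N] unfolding N_def by auto
  ultimately show False using not_inverse_in_ring y(2) by blast
qed

lemma value_ideal:
  "ideal {y \<in> R n. y = \<zero> \<or> c \<le> v y} (ring_at n)" (is "ideal ?D _")
proof (rule member.ideal_of_closed)
  note sub = subringE[OF subring[of n]]
  show "?D \<subseteq> carrier (ring_at n)" by auto
  show "\<zero>\<^bsub>ring_at n\<^esub> \<in> ?D" using sub(2) by simp
next
  note sub = subringE[OF subring[of n]]
  fix a b assume a: "a \<in> ?D" and b: "b \<in> ?D"
  have abc: "a \<in> carrier K" "b \<in> carrier K" using a b ring_at_carrier by blast+
  have "c \<le> v (a \<oplus> b)" if nz: "a \<oplus> b \<noteq> \<zero>"
  proof (cases "a = \<zero> \<or> b = \<zero>")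
    case True
    then show ?thesis using a b nz abc by auto
  next
    case False
    then show ?thesis using val_add[of a b] nz a b abc by auto
  qed
  then show "a \<oplus>\<^bsub>ring_at n\<^esub> b \<in> ?D" using a b sub(7) by auto
next
  note sub = subringE[OF subring[of n]]
  fix a r assume a: "a \<in> ?D" and r': "r \<in> carrier (ring_at n)"
  have r: "r \<in> R n" using r' by simp
  have arc: "a \<in> carrier K" "r \<in> carrier K" using a r ring_at_carrier by blast+
  have "c \<le> v (r \<otimes> a)" if nz: "r \<otimes> a \<noteq> \<zero>"
  proof -
    have "r \<noteq> \<zero>" "a \<noteq> \<zero>" using nz arc by auto
    then show ?thesis using val_mult[of r a] val_nonneg[OF r] a arc by auto
  qed
  then show "r \<otimes>\<^bsub>ring_at n\<^esub> a \<in> ?D" using a r sub(6) by auto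
qed

lemma value_bounded_below:
  obtains \<epsilon> where "0 < \<epsilon>" "\<And>y. y \<in> \<mm> n \<Longrightarrow> y \<noteq> \<zero> \<Longrightarrow> \<epsilon> \<le> v y"
proof -
  obtain S where S: "S \<subseteq> R n" "finite S" "\<mm> n = Idl\<^bsub>ring_at n\<^esub> S"
    using member.finetely_gen[OF member.is_ideal, of n] by auto
  define \<epsilon> where "\<epsilon> = Min (insert 1 (v ` (S - {\<zero>})))"
  have fin: "finite (insert 1 (v ` (S - {\<zero>})))" using S(2) by simp
  have "S \<subseteq> \<mm> n" using S member.genideal_self[of S n] by simp
  then have "0 < \<epsilon>" unfolding \<epsilon>_def using fin val_pos by (subst Min_gr_iff) auto
  moreover have "S \<subseteq> {y \<in> R n. y = \<zero> \<or> \<epsilon> \<le> v y}"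
    using S(1) Min_le[OF fin] unfolding \<epsilon>_def by auto
  then have "\<mm> n \<subseteq> {y \<in> R n. y = \<zero> \<or> \<epsilon> \<le> v y}"
    unfolding S(3) by (rule member.genideal_minimal[OF value_ideal])
  ultimately show thesis using that by blast
qed

text \<open>The valuation makes the intersection of the powers of \<open>\<mm> n\<close> trivial: \<open>\<mm> n\<close> is finitely generated, so the values of
its nonzero elements are bounded below by some \<open>\<epsilon> > 0\<close>, and nonzero elements of the \<open>k\<close>-th power have value at least \<open>k \<epsilon>\<close>.\<close>

lemma not_in_all_powers:
  assumes y: "y \<in> R n" "y \<noteq> \<zero>"
  obtains N where "y \<notin> ideal_pow (ring_at n) (\<mm> n) N"
proof -
  obtain \<epsilon> where \<epsilon>: "0 < \<epsilon>" "\<And>y. y \<in> \<mm> n \<Longrightarrow> y \<noteq> \<zero> \<Longrightarrow> \<epsilon> \<le> v y"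
    using value_bounded_below[of n] by blast
  have pow: "ideal_pow (ring_at n) (\<mm> n) k \<subseteq> {y \<in> R n. y = \<zero> \<or> k * \<epsilon> \<le> v y}" for k
  proof (induction k)
    case 0
    then show ?case using val_nonneg by (auto simp: member.ideal_pow_0)
  next
    case (Suc k)
    show ?case
      unfolding member.ideal_pow_Suc
    proof (rule member.ideal_prod_subset_ideal[OF value_ideal])
      fix a b assume a: "a \<in> ideal_pow (ring_at n) (\<mm> n) k" and b: "b \<in> \<mm> n"
      have aD: "a \<in> R n" "a = \<zero> \<or> k * \<epsilon> \<le> v a" using a Suc.IH by auto
      have bR: "b \<in> R n" using b maximal_ideal_subset by blast
      have c: "a \<in> carrier K" "b \<in> carrier K" using aD bR ring_at_carrier by auto
      have "Suc k * \<epsilon> \<le> v (a \<otimes> b)" if nz: "a \<otimes> b \<noteq> \<zero>"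
      proof -
        have "a \<noteq> \<zero>" "b \<noteq> \<zero>" using nz c by auto
        then have "v (a \<otimes> b) = v a + v b" "k * \<epsilon> \<le> v a" "\<epsilon> \<le> v b"
          using val_mult c aD \<epsilon>(2) b by auto
        then show ?thesis by (simp add: algebra_simps)
      qed
      then show "a \<otimes>\<^bsub>ring_at n\<^esub> b \<in> {y \<in> R n. y = \<zero> \<or> Suc k * \<epsilon> \<le> v y}"
        using subringE(6)[OF subring[of n] aD(1) bR] by auto
    qed
  qed
  obtain N :: nat where "v y < N * \<epsilon>" using reals_Archimedean3[OF \<epsilon>(1)] by blast
  then have "y \<notin> ideal_pow (ring_at n) (\<mm> n) N" using pow[of N] y(2) by auto
  then show thesis using that by blast
qed

lemma order_at:
  assumes "y \<in> R n" "y \<noteq> \<zero>"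
  shows "y \<in> ideal_pow (ring_at n) (\<mm> n) (order_at n y) - ideal_pow (ring_at n) (\<mm> n) (Suc (order_at n y))"
proof -
  obtain N where "y \<notin> ideal_pow (ring_at n) (\<mm> n) N" using not_in_all_powers[OF assms] .
  then show ?thesis using member.ord_at_mem[of y n N] assms by simp
qed

lemma order_at_pos:
  assumes "y \<in> \<mm> n" "y \<noteq> \<zero>"
  shows "0 < order_at n y"
proof (rule ccontr)
  assume "\<not> 0 < order_at n y"
  then have "y \<notin> \<mm> n"
    using order_at[of y n] assms maximal_ideal_subset by (auto simp: member.ideal_pow_1[OF member.is_ideal])
  then show False using assms by simp
qed

text \<open>The hypothesis says that \<open>f\<^sup>p / g\<^sup>q\<close> has nonnegative value. It thus lies in \<open>R n\<close> for all large \<open>n\<close>,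
where \<open>f\<^sup>p\<close> is a multiple of \<open>g\<^sup>q\<close>, and the orders of these powers are \<open>p\<close> and \<open>q\<close> times those of \<open>f\<close>
and \<open>g\<close>.\<close>

lemma eventually_order_le:
  assumes f: "f \<in> \<mm> 0 - {\<zero>}" and g: "g \<in> \<mm> 0 - {\<zero>}" and le: "real q * v g \<le> real p * v f"
  shows "\<forall>\<^sub>F n in sequentially. q * order_at n g \<le> p * order_at n f"
proof -
  have fc: "f \<in> carrier K - {\<zero>}" and gc: "g \<in> carrier K - {\<zero>}"
    using f g maximal_ideal_subset ring_at_carrier by blast+
  note fp = pow_nonzero[OF fc, of p] and gq = pow_nonzero[OF gc, of q]
  define h where "h = f [^] p \<otimes> inv (g [^] q)"
  have hc: "h \<in> carrier K" unfolding h_def using fp inv_closed[OF gq] by simp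
  have "v h = p * v f - q * v g"
    unfolding h_def using val_mult[OF fp inv_closed[OF gq]] val_inv[OF gq] val_pow[OF fc] val_pow[OF gc] by simp
  then have "h \<in> (\<Union>n. R n)" using le hc unfolding valuation_ring_eq[symmetric] valuation_ring_def by simp
  then obtain n0 where n0: "h \<in> R n0" by blast
  have gh: "g [^] q \<otimes> h = f [^] p"
  proof -
    have "g [^] q \<otimes> h = (inv (g [^] q) \<otimes> g [^] q) \<otimes> f [^] p"
      unfolding h_def using fp gq inv_closed[OF gq] by (simp add: m_ac)
    then show ?thesis using inv_mult(1)[OF gq] fp by simp
  qed
  have "q * order_at n g \<le> p * order_at n f" if n: "n0 \<le> n" for n
  proof -
    let ?I = "ideal_pow (ring_at n) (\<mm> n)"
    have fR: "f \<in> R n" and gR: "g \<in> R n" and hR: "h \<in> R n"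
      using f g n0 maximal_ideal_subset[of 0] ring_at_mono[of 0 n] ring_at_mono[OF n] by auto
    have "g [^] q \<in> ?I (q * order_at n g)"
      using member.order_power[OF order_at[OF gR], of q] g nat_pow_consistent by auto
    then have "g [^] q \<otimes> h \<in> ?I (q * order_at n g)"
      using member.ideal_closed(6)[OF member.ideal_ideal_pow[OF member.is_ideal], of "g [^] q" n _ h] hR by simp
    then have "f [^] p \<in> ?I (q * order_at n g)" using gh by simp
    moreover have "f [^] p \<notin> ?I (Suc (p * order_at n f))"
      using member.order_power[OF order_at[OF fR], of p] f nat_pow_consistent by auto
    ultimately have "\<not> Suc (p * order_at n f) \<le> q * order_at n g"
      using member.ideal_pow_antimono[of "Suc (p * order_at n f)" "q * order_at n g" n] by blast
    then show ?thesis by simp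
  qed
  then show ?thesis unfolding eventually_sequentially by blast
qed

theorem order_quotient_tendsto:
  assumes f: "f \<in> \<mm> 0 - {\<zero>}" and g: "g \<in> \<mm> 0 - {\<zero>}"
  shows "(\<lambda>n. real (order_at n f) / real (order_at n g)) \<longlonglongrightarrow> v f / v g"
proof -
  have vf: "0 < v f" and vg: "0 < v g" using val_pos f g by blast+
  have og: "0 < order_at n g" for n using order_at_pos[of g n] g maximal_ideal_mono[of 0 n] by auto
  have rat: "\<exists>q p. 0 < p \<and> a < real q / real p \<and> real q / real p < b"
    if nonneg: "0 \<le> a" and less: "a < b" for a b :: real
  proof -
    obtain r :: rat where r: "a < of_rat r" "of_rat r < b" using of_rat_dense[OF less] by blast
    obtain i j where ij: "r = Fract i j" "j > 0" by (cases r) auto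
    have "0 < (of_rat r :: real)" using r(1) nonneg by linarith
    then have "0 < r" by simp
    then have "0 < i" using ij by (simp add: zero_less_Fract_iff)
    then have "of_rat r = real (nat i) / real (nat j)" using ij by (simp add: of_rat_rat)
    then show ?thesis using r ij by (intro exI[of _ "nat i"] exI[of _ "nat j"]) simp
  qed
  show ?thesis
  proof (rule order_tendstoI)
    fix a assume a: "a < v f / v g"
    obtain q p where p: "0 < p" and aq: "max 0 a < real q / real p" and ql: "real q / real p < v f / v g"
      using rat[of "max 0 a" "v f / v g"] a vf vg by auto
    have "real q * v g \<le> real p * v f" using ql p vg by (simp add: field_simps)
    from eventually_order_le[OF f g this]
    show "\<forall>\<^sub>F n in sequentially. a < real (order_at n f) / real (order_at n g)"
    proof eventually_elim
      case (elim n)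
      then have "real q * real (order_at n g) \<le> real p * real (order_at n f)"
        by (metis of_nat_le_iff of_nat_mult)
      then have "real q / real p \<le> real (order_at n f) / real (order_at n g)"
        using p og[of n] by (simp add: field_simps)
      then show ?case using aq by simp
    qed
  next
    fix a assume a: "v f / v g < a"
    obtain q p where p: "0 < p" and aq: "v f / v g < real q / real p" and ql: "real q / real p < a"
      using rat[of "v f / v g" a] a vf vg by auto
    have "real p * v f \<le> real q * v g" using aq p vg by (simp add: field_simps)
    from eventually_order_le[OF g f this]
    show "\<forall>\<^sub>F n in sequentially. real (order_at n f) / real (order_at n g) < a"
    proof eventually_elim
      case (elim n)
      then have "real p * real (order_at n f) \<le> real q * real (order_at n g)"
        by (metis of_nat_le_iff of_nat_mult)
      then have "real (order_at n f) / real (order_at n g) \<le> real q / real p"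
        using p og[of n] by (simp add: field_simps)
      then show ?case using ql by simp
    qed
  qed
qed

end

theorem corollary3p10:
  fixes K :: "('a, 'b) ring_scheme"
    and R \<mm> :: "nat \<Rightarrow> 'a set"
    and v :: "'a \<Rightarrow> real"
    and f g :: 'a
  assumes "quadratic_family K R \<mm>"
    and "switches_strongly_infinitely_often K R"
    and "real_valuation K v"
    and "valuation_ring K v = (\<Union>n. R n)"
    and "f \<in> \<mm> 0 - {\<zero>\<^bsub>K\<^esub>}"
    and "g \<in> \<mm> 0 - {\<zero>\<^bsub>K\<^esub>}"
  shows "(\<lambda>n. real (ord_at (restrict_ring K (R n)) (\<mm> n) f) /
              real (ord_at (restrict_ring K (R n)) (\<mm> n) g))
         \<longlonglongrightarrow> v f / v g"
proof -
  interpret valued_quadratic_family K R \<mm> v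
    using assms(1,3,4) by (simp add: valued_quadratic_family_def valued_quadratic_family_axioms_def)
  show ?thesis using order_quotient_tendsto assms(5,6) by blast
qed

end
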